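(* Let $\Gamma$ be a $\mathbb{Q}$-arithmetic cocompact reflection group in the three-dimensional Lobachevsky (hyperbolic) space $\mathbb{L}^3$, and let $P\subset\mathbb{L}^3$ be its fundamental polyhedron. Then $P$ has an edge of width less than $4.14$.
   Context: A quadratic lattice is a free Abelian group of finite rank with a non-degenerate integral symmetric bilinear form $(\cdot,\cdot)$ (the inner product); it is hyperbolic if the form has signature $(n,1)$. For a hyperbolic lattice $L$ of rank $n+1$, put $V=L\otimes\mathbb{R}=\mathbb{E}^{n,1}$; the Lobachevsky space $\mathbb{L}^n$ is one connected component of $\{x\in V\mid (x,x)=-1\}$, with metric $\rho$ given by $\cosh\rho(v,w)=-(v,w)$. Let $\mathcal{O}'(L)$ be the group of automorphisms of $L$ that preserve each connected component of this hyperboloid; it is a discrete group of motions of $\mathbb{L}^n$. A $\mathbb{Q}$-arithmetic reflection group in $\mathbb{L}^3$ is a discrete group generated by reflections in hyperplanes of $\mathbb{L}^3$ that is a finite index subgroup of a group of the form $\mathcal{O}'(L)$, where $L$ is a hyperbolic lattice of rank $4$. It is cocompact if its fundamental polyhedron is compact. The fundamental polyhedron of a discrete reflection group is the closure of a connected component of the complement in $\mathbb{L}^3$ of the union of the mirrors of all reflections of the group. Width of an edge: faces of a polyhedron in $\mathbb{L}^3$ are its two-dimensional faces. Let $P$ be a compact acute-angled polyhedron in $\mathbb{L}^3$ (all dihedral angles are at most $\pi/2$) and let $E$ be an edge of $P$. Let $F_1,F_2$ be the faces containing $E$. Let $F_3$ and $F_4$ be the faces containing one and the other vertex of $E$, respectively,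 but not containing $E$ itself (the framing faces of $E$), and let $u_3,u_4\in\mathbb{E}^{3,1}$ be the unit outer normals to $F_3$ and $F_4$. The width of $E$ is the number $|(u_3,u_4)|$. *)

theory Defs
  imports "HOL-Analysis.Analysis" "HOL-Algebra.Generated_Groups"
begin

section \<open>Pseudo-Euclidean space and the Lobachevsky space\<close>

text \<open>The space \<open>E^{n,1}\<close> is modelled as \<open>\<real>^n \<times> \<real>\<close>, the last coordinate being the negative one.\<close>

type_synonym 'n pseudo_euclidean = "(real ^ 'n) \<times> real"

definition mink :: "'n::finite pseudo_euclidean \<Rightarrow> 'n pseudo_euclidean \<Rightarrow> real" where
  "mink x y = fst x \<bullet> fst y - snd x * snd y"

definition hyperboloid :: "'n::finite pseudo_euclidean set" where
  "hyperboloid = {x. mink x x = -1}"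

text \<open>The chosen component of the hyperboloid is the upper sheet. Its intrinsic metric
  \<open>arcosh (- mink v w)\<close> induces the subspace topology of the ambient space, in which it is closed;
  hence compactness and closure are taken in the ambient space below.\<close>

definition lobachevsky :: "'n::finite pseudo_euclidean set" where
  "lobachevsky = {x \<in> hyperboloid. snd x > 0}"

text \<open>Motions of the Lobachevsky space are represented by their unique linear extensions.\<close>

definition motions :: "('n::finite pseudo_euclidean \<Rightarrow> 'n pseudo_euclidean) monoid" where
  "motions = \<lparr>carrier = {g. linear g \<and> (\<forall>x y. mink (g x) (g y) = mink x y)
                            \<and> g ` lobachevsky = lobachevsky},
              mult = (\<circ>), one = id\<rparr>"


section \<open>Hyperbolic lattices\<close>

definition int_span :: "'a::real_vector set \<Rightarrow> 'a set" where
  "int_span B = {\<Sum>b\<in>B. of_int (c b) *\<^sub>R b | c. True}"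

text \<open>A hyperbolic lattice \<open>L\<close> of rank \<open>n + 1\<close> is regarded as a subgroup of
  \<open>L \<otimes> \<real> = E^{n,1}\<close>, its form being the restriction of \<^const>\<open>mink\<close>. As \<open>L\<close> has a \<open>\<int>\<close>-basis that is
  an \<open>\<real>\<close>-basis of \<open>E^{n,1}\<close>, nondegeneracy and signature \<open>(n,1)\<close> are inherited from the ambient
  form.\<close>

definition hyperbolic_lattice :: "'n::finite pseudo_euclidean set \<Rightarrow> bool" where
  "hyperbolic_lattice L \<longleftrightarrow>
     (\<exists>B. independent B \<and> card B = CARD('n) + 1 \<and> L = int_span B) \<and>
     (\<forall>x\<in>L. \<forall>y\<in>L. mink x y \<in> \<int>)"

text \<open>The group \<open>O'(L)\<close>; an automorphism of \<open>L\<close> is represented by its \<open>\<real>\<close>-linear extension.\<close>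

definition lattice_group ::
    "'n::finite pseudo_euclidean set \<Rightarrow> ('n pseudo_euclidean \<Rightarrow> 'n pseudo_euclidean) set" where
  "lattice_group L =
     {g. linear g \<and> (\<forall>x y. mink (g x) (g y) = mink x y) \<and> g ` L = L \<and>
         (\<forall>C \<in> components hyperboloid. g ` C = C)}"


section \<open>Reflection groups\<close>

definition hyperplane :: "'n::finite pseudo_euclidean \<Rightarrow> 'n pseudo_euclidean set" where
  "hyperplane e = {x \<in> lobachevsky. mink e x = 0}"

definition reflection ::
    "'n::finite pseudo_euclidean \<Rightarrow> 'n pseudo_euclidean \<Rightarrow> 'n pseudo_euclidean" where
  "reflection e x = x - (2 * mink e x / mink e e) *\<^sub>R e"

text \<open>The condition \<open>mink e e > 0\<close> says that \<^term>\<open>hyperplane e\<close> is indeed a hyperplane of the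
  Lobachevsky space. The predicate \<^const>\<open>discrete\<close> refers to the topology of pointwise convergence,
  which on linear maps is the usual one.\<close>

definition discrete_reflection_group ::
    "('n::finite pseudo_euclidean \<Rightarrow> 'n pseudo_euclidean) set \<Rightarrow> bool" where
  "discrete_reflection_group \<Gamma> \<longleftrightarrow>
     (\<exists>R. R \<subseteq> {reflection e | e. mink e e > 0} \<and> \<Gamma> = generate motions R) \<and> discrete \<Gamma>"

definition arithmetic_reflection_group ::
    "('n::finite pseudo_euclidean \<Rightarrow> 'n pseudo_euclidean) set \<Rightarrow> bool" where
  "arithmetic_reflection_group \<Gamma> \<longleftrightarrow>
     discrete_reflection_group \<Gamma> \<and>
     (\<exists>L. hyperbolic_lattice L \<and>
          subgroup \<Gamma> (motions\<lparr>carrier := lattice_group L\<rparr>) \<and>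
          finite (rcosets\<^bsub>motions\<lparr>carrier := lattice_group L\<rparr>\<^esub> \<Gamma>))"

definition mirrors ::
    "('n::finite pseudo_euclidean \<Rightarrow> 'n pseudo_euclidean) set \<Rightarrow> 'n pseudo_euclidean set set" where
  "mirrors \<Gamma> = {hyperplane e | e. mink e e > 0 \<and> reflection e \<in> \<Gamma>}"

definition fundamental_polyhedron ::
    "('n::finite pseudo_euclidean \<Rightarrow> 'n pseudo_euclidean) set \<Rightarrow> 'n pseudo_euclidean set \<Rightarrow> bool" where
  "fundamental_polyhedron \<Gamma> P \<longleftrightarrow>
     (\<exists>C \<in> components (lobachevsky - \<Union>(mirrors \<Gamma>)). P = closure C)"

text \<open>Fundamental polyhedra of \<open>\<Gamma>\<close> are permuted transitively by \<open>\<Gamma>\<close>, so they are all compact if one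
  of them is.\<close>

definition cocompact ::
    "('n::finite pseudo_euclidean \<Rightarrow> 'n pseudo_euclidean) set \<Rightarrow> bool" where
  "cocompact \<Gamma> \<longleftrightarrow> (\<forall>P. fundamental_polyhedron \<Gamma> P \<longrightarrow> compact P)"


section \<open>Faces of polyhedra and the width of an edge\<close>

text \<open>The vector \<open>u\<close> is the unit outer normal of a hyperplane supporting \<open>P\<close> exactly along \<open>F\<close>.\<close>

definition unit_outer_normal ::
    "'n::finite pseudo_euclidean set \<Rightarrow> 'n pseudo_euclidean set \<Rightarrow> 'n pseudo_euclidean \<Rightarrow> bool" where
  "unit_outer_normal P F u \<longleftrightarrow>
     mink u u = 1 \<and> (\<forall>x\<in>P. mink u x \<le> 0) \<and> F = P \<inter> hyperplane u"

text \<open>A \<open>k\<close>-dimensional (proper) face; a \<open>k\<close>-dimensional plane of the Lobachevsky space spans a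
  \<open>(k+1)\<close>-dimensional linear subspace, and \<^const>\<open>dim\<close> is the dimension of the linear span.\<close>

definition dim_face ::
    "nat \<Rightarrow> 'n::finite pseudo_euclidean set \<Rightarrow> 'n pseudo_euclidean set \<Rightarrow> bool" where
  "dim_face k P F \<longleftrightarrow> (\<exists>u. unit_outer_normal P F u) \<and> dim F = k + 1"

definition is_vertex :: "3 pseudo_euclidean set \<Rightarrow> 3 pseudo_euclidean \<Rightarrow> bool" where
  "is_vertex P v \<longleftrightarrow> dim_face 0 P {v}"

definition is_edge :: "3 pseudo_euclidean set \<Rightarrow> 3 pseudo_euclidean set \<Rightarrow> bool" where
  "is_edge P E \<longleftrightarrow> dim_face 1 P E"

definition is_face :: "3 pseudo_euclidean set \<Rightarrow> 3 pseudo_euclidean set \<Rightarrow> bool" where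
  "is_face P F \<longleftrightarrow> dim_face 2 P F"

definition framing_faces ::
    "3 pseudo_euclidean set \<Rightarrow> 3 pseudo_euclidean set \<Rightarrow>
     3 pseudo_euclidean set \<Rightarrow> 3 pseudo_euclidean set \<Rightarrow> bool" where
  "framing_faces P E F\<^sub>3 F\<^sub>4 \<longleftrightarrow>
     is_face P F\<^sub>3 \<and> is_face P F\<^sub>4 \<and> \<not> E \<subseteq> F\<^sub>3 \<and> \<not> E \<subseteq> F\<^sub>4 \<and>
     (\<exists>v w. is_vertex P v \<and> is_vertex P w \<and> v \<noteq> w \<and> v \<in> E \<and> w \<in> E \<and> v \<in> F\<^sub>3 \<and> w \<in> F\<^sub>4)"

text \<open>For an edge of a compact acute-angled polyhedron the framing faces are unique up to order, as
  exactly three faces meet at each vertex; so the description is definite.\<close>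

definition edge_width :: "3 pseudo_euclidean set \<Rightarrow> 3 pseudo_euclidean set \<Rightarrow> real" where
  "edge_width P E =
     (THE d. \<exists>F\<^sub>3 F\<^sub>4 u\<^sub>3 u\<^sub>4. framing_faces P E F\<^sub>3 F\<^sub>4 \<and>
               unit_outer_normal P F\<^sub>3 u\<^sub>3 \<and> unit_outer_normal P F\<^sub>4 u\<^sub>4 \<and> d = \<bar>mink u\<^sub>3 u\<^sub>4\<bar>)"


section \<open>Basic facts\<close>

lemma lobachevsky_eq_graph:
  "(lobachevsky :: 'n::finite pseudo_euclidean set) = range (\<lambda>x. (x, sqrt (1 + x \<bullet> x)))"
proof (rule Set.set_eqI)
  fix p :: "'n pseudo_euclidean"
  obtain x t where p: "p = (x, t)" by (cases p)
  have "p \<in> lobachevsky \<longleftrightarrow> t\<^sup>2 = 1 + x \<bullet> x \<and> t > 0"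
    by (auto simp: p lobachevsky_def hyperboloid_def mink_def power2_eq_square)
  also have "\<dots> \<longleftrightarrow> t = sqrt (1 + x \<bullet> x)"
  proof
    assume "t\<^sup>2 = 1 + x \<bullet> x \<and> t > 0"
    then show "t = sqrt (1 + x \<bullet> x)" by (metis less_imp_le real_sqrt_unique)
  next
    assume t: "t = sqrt (1 + x \<bullet> x)"
    have "0 < 1 + x \<bullet> x" by (simp add: add_pos_nonneg)
    then show "t\<^sup>2 = 1 + x \<bullet> x \<and> t > 0" by (simp add: t)
  qed
  also have "\<dots> \<longleftrightarrow> p \<in> range (\<lambda>x. (x, sqrt (1 + x \<bullet> x)))"
    by (auto simp: p)
  finally show "p \<in> lobachevsky \<longleftrightarrow> p \<in> range (\<lambda>x. (x, sqrt (1 + x \<bullet> x)))" .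
qed

lemma lobachevsky_component:
  "(lobachevsky :: 'n::finite pseudo_euclidean set) \<in> components hyperboloid"
proof -
  have conn: "connected (lobachevsky :: 'n pseudo_euclidean set)"
    unfolding lobachevsky_eq_graph
    by (intro connected_continuous_image continuous_intros) auto
  have ne: "(lobachevsky :: 'n pseudo_euclidean set) \<noteq> {}"
    unfolding lobachevsky_eq_graph by simp
  have nz: "snd x \<noteq> 0" if "x \<in> hyperboloid" for x :: "'n pseudo_euclidean"
    using that inner_ge_zero[of "fst x"]
    by (auto simp: hyperboloid_def mink_def simp del: inner_ge_zero)
  have max: "D = lobachevsky"
    if D: "D \<noteq> {}" "lobachevsky \<subseteq> D" "D \<subseteq> hyperboloid" "connected D"
    for D :: "'n pseudo_euclidean set"
  proof (rule ccontr)
    assume "D \<noteq> lobachevsky"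
    then obtain y where y: "y \<in> D" "y \<notin> lobachevsky" using D by blast
    obtain x :: "'n pseudo_euclidean" where x: "x \<in> lobachevsky" using ne by blast
    have sy: "snd y \<le> 0" using y D by (auto simp: lobachevsky_def)
    have "connected (snd ` D)"
      by (intro connected_continuous_image continuous_intros \<open>connected D\<close>)
    moreover have "snd x > 0" "snd x \<in> snd ` D" "snd y \<in> snd ` D"
      using x y D by (auto simp: lobachevsky_def)
    ultimately have "0 \<in> snd ` D"
      using sy by (meson connected_iff_interval less_imp_le)
    then show False using nz D(3) by fastforce
  qed
  show ?thesis
    unfolding in_components_maximal
    using conn ne max by (auto simp: lobachevsky_def)
qed

lemma lattice_group_subset_motions: "lattice_group L \<subseteq> carrier motions"
proof
  fix g assume "g \<in> lattice_group L"
  then have g: "linear g" "\<forall>x y. mink (g x) (g y) = mink x y" "\<forall>C\<in>components hyperboloid. g ` C = C"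
    unfolding lattice_group_def by blast+
  then have "g ` lobachevsky = lobachevsky" using lobachevsky_component by blast
  with g show "g \<in> carrier motions" by (simp add: motions_def)
qed

end

(* Let q be an interior point of P, and among the edges of P take one, E, whose line is farthest
   from q. Let F1, F2 be the faces through E and V an end of E; exactly three edges meet at V. That
   the other two edges at V are not farther from q than E bounds the distance from V to the foot of
   the perpendicular dropped from q to E in terms of the dihedral angles at V only. The two bounds
   together bound the length of E, and with the dihedral angles at both ends this bounds the width.
   Since the group preserves a lattice, 4 cos^2 of a dihedral angle is an integer, so the angles are
   pi/2, pi/3, pi/4 or pi/6 and only finitely many vertex types occur. All estimates are made in
   terms of the Gram matrix of the outer normals of the four faces at E and their products with q. *)

theory Submission
  imports Defs
begin

section \<open>Minkowski geometry\<close>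

text \<open>Let F1 be a face through E, alpha its plane angle at V. If the other edge of F1 at V is
  not farther from q than E, the projection of q to F1 lies on the side of the bisector of alpha
  away from E. So sinh of the distance from q to the plane through V orthogonal to E is at most
  cot(alpha/2) times sinh of its distance to the plane through E orthogonal to F1. F2 gives a second
  such bound. D, the square of sinh of the distance from q to E, is a quadratic form in the two
  distances to planes through E; eliminating them bounds the foot by D. The ends of E may be of
  different types. Each is estimated alone, in the form 2 y^2 <= (K - e) D: so normalised, the
  addition formula for cosh yields Z <= (K + K')/2, where Z = sqrt(e e') cosh(length of E). The
  width is Z minus a nonnegative expression in the cosines of the dihedral angles. K = 3.8 serves
  every vertex type except that with angle pi/4 at E and pi/2, pi/3 at the other two edges, which
  gets K = 4.2; if both ends are exceptional, the subtracted expression is at least 1/4. So the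
  bound obtained is 4 in the worst case.\<close>

lemma bounded_bilinear_sub:
  assumes "bounded_bilinear f" "bounded_bilinear g"
  shows "bounded_bilinear (\<lambda>x y. f x y - g x y)"
proof -
  interpret f: bounded_bilinear f by fact
  interpret g: bounded_bilinear g by fact
  obtain K where K: "\<And>x y. norm (f x y) \<le> norm x * norm y * K" using f.bounded by blast
  obtain M where M: "\<And>x y. norm (g x y) \<le> norm x * norm y * M" using g.bounded by blast
  show ?thesis
  proof
    show "\<exists>K. \<forall>a b. norm (f a b - g a b) \<le> norm a * norm b * K"
    proof (intro exI allI)
      fix a b
      show "norm (f a b - g a b) \<le> norm a * norm b * (K + M)"
        using norm_triangle_ineq4[of "f a b" "g a b"] K[of a b] M[of a b]
        by (simp add: algebra_simps)
    qed
  qed (simp_all add: f.add_left f.add_right g.add_left g.add_right f.scaleR_left f.scaleR_right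
      g.scaleR_left g.scaleR_right algebra_simps)
qed

lemma bounded_bilinear_mink: "bounded_bilinear (mink :: 'n::finite pseudo_euclidean \<Rightarrow> _)"
proof -
  have "bounded_bilinear (\<lambda>x y :: 'n pseudo_euclidean. fst x \<bullet> fst y)"
    by (rule bounded_bilinear.comp[OF bounded_bilinear_inner bounded_linear_fst bounded_linear_fst])
  moreover have "bounded_bilinear (\<lambda>x y :: 'n pseudo_euclidean. snd x * snd y)"
    by (rule bounded_bilinear.comp[OF bounded_bilinear_mult bounded_linear_snd bounded_linear_snd])
  ultimately show ?thesis
    unfolding mink_def by (rule bounded_bilinear_sub)
qed

interpretation mink: bounded_bilinear "mink :: 'n::finite pseudo_euclidean \<Rightarrow> _"
  by (rule bounded_bilinear_mink)

lemmas mink_expand = mink.add_left mink.add_right mink.diff_left mink.diff_right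
  mink.scaleR_left mink.scaleR_right mink.minus_left mink.minus_right

lemma mink_commute: "mink x y = mink y x"
  by (simp add: mink_def inner_commute mult.commute)

lemma mink_nondegenerate: "(\<And>y. mink x y = 0) \<Longrightarrow> x = 0"
proof -
  assume a: "\<And>y. mink x y = 0"
  have "fst x \<bullet> fst x = 0" using a[of "(fst x, 0)"] by (simp add: mink_def)
  moreover have "snd x = 0" using a[of "(0, 1)"] by (simp add: mink_def)
  ultimately show "x = 0" by (simp add: prod_eq_iff)
qed

lemma subspace_mink_orthogonal: "subspace {x. mink u x = 0}"
  by (auto simp: subspace_def mink_expand mink.zero_right)

lemma dim_mink_orthogonal:
  fixes u :: "'n::finite pseudo_euclidean"
  assumes "u \<noteq> 0"
  shows "dim {x. mink u x = 0} = CARD('n)"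
proof -
  have "{x. mink u x = 0} = {x. (fst u, - snd u) \<bullet> x = 0}"
    by (auto simp: mink_def inner_prod_def)
  moreover have "(fst u, - snd u) \<noteq> 0" using assms by (auto simp: prod_eq_iff)
  ultimately show ?thesis by (simp add: dim_hyperplane)
qed

text \<open>Flipping the last coordinate turns Euclidean orthogonality into
  \<open>mink\<close>-orthogonality, and \<open>A\<close> has fewer elements than the dimension
  \<open>CARD('n) + 1\<close>.\<close>

lemma mink_orthogonal_exists:
  fixes A :: "'n::finite pseudo_euclidean set"
  assumes "finite A" "card A \<le> CARD('n)"
  obtains d where "d \<noteq> 0" "\<And>a. a \<in> A \<Longrightarrow> mink a d = 0"
proof -
  have "dim A < DIM('n pseudo_euclidean)"
    using dim_le_card'[OF assms(1)] assms(2) by simp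
  then obtain x where x: "x \<noteq> 0" "\<And>y. y \<in> span A \<Longrightarrow> orthogonal x y"
    using orthogonal_to_subspace_exists by metis
  show ?thesis
  proof (rule that[of "(fst x, - snd x)"])
    show "(fst x, - snd x) \<noteq> 0" using x(1) by (auto simp: prod_eq_iff)
    show "mink a (fst x, - snd x) = 0" if "a \<in> A" for a
      using x(2)[OF span_base[OF that]]
      by (simp add: mink_def orthogonal_def inner_prod_def inner_commute mult.commute)
  qed
qed

text \<open>The open cone over the Lobachevsky space. Segments between points of the hyperboloid
  leave the hyperboloid but not this convex cone, so arguments along segments and rays take place
  here and end with a central projection, \<open>normalize_point\<close>.\<close>

definition future_cone :: "'n::finite pseudo_euclidean set" where
  "future_cone = {x. norm (fst x) < snd x}"

lemma future_cone_iff: "x \<in> future_cone \<longleftrightarrow> mink x x < 0 \<and> snd x > 0"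
proof -
  have "mink x x < 0 \<longleftrightarrow> (norm (fst x))\<^sup>2 < (snd x)\<^sup>2"
    by (simp add: mink_def dot_square_norm flip: power2_eq_square)
  moreover have "(norm (fst x))\<^sup>2 < (snd x)\<^sup>2 \<longleftrightarrow> norm (fst x) < snd x" if "snd x > 0"
    using that by (simp add: power_mono_iff flip: not_le)
  moreover have "snd x > 0" if "norm (fst x) < snd x"
    using that norm_ge_zero order.strict_trans1 by blast
  ultimately show ?thesis
    unfolding future_cone_def by blast
qed

lemma lobachevsky_subset_future_cone: "lobachevsky \<subseteq> future_cone"
  by (auto simp: future_cone_iff lobachevsky_def hyperboloid_def)

lemma future_cone_scaleR: "x \<in> future_cone \<Longrightarrow> c > 0 \<Longrightarrow> c *\<^sub>R x \<in> future_cone"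
  by (simp add: future_cone_def)

lemma future_cone_add: "x \<in> future_cone \<Longrightarrow> y \<in> future_cone \<Longrightarrow> x + y \<in> future_cone"
  using norm_triangle_ineq[of "fst x" "fst y"] by (simp add: future_cone_def)

lemma future_cone_segment:
  assumes "x \<in> future_cone" "y \<in> future_cone" "0 \<le> t" "t \<le> 1"
  shows "(1 - t) *\<^sub>R x + t *\<^sub>R y \<in> future_cone"
proof (cases "t = 0 \<or> t = 1")
  case False
  then show ?thesis using assms by (intro future_cone_add future_cone_scaleR) auto
qed (use assms in auto)

lemma open_future_cone: "open future_cone"
  unfolding future_cone_def by (intro open_Collect_less continuous_intros)

definition normalize_point :: "'n::finite pseudo_euclidean \<Rightarrow> 'n pseudo_euclidean" where
  "normalize_point x = (1 / sqrt (- mink x x)) *\<^sub>R x"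

lemma normalize_pointE:
  assumes "x \<in> future_cone"
  obtains s where "s > 0" "normalize_point x = s *\<^sub>R x" "normalize_point x \<in> lobachevsky"
proof (rule that[of "1 / sqrt (- mink x x)"])
  have x: "mink x x < 0" "snd x > 0" using assms by (auto simp: future_cone_iff)
  then show "1 / sqrt (- mink x x) > 0" by simp
  have "sqrt (- mink x x) * sqrt (- mink x x) = - mink x x" using x by simp
  then have "(1 / sqrt (- mink x x)) * (1 / sqrt (- mink x x)) = 1 / (- mink x x)" by simp
  then show "normalize_point x \<in> lobachevsky" using x
    by (simp add: lobachevsky_def hyperboloid_def normalize_point_def mink_expand field_simps)
qed (simp add: normalize_point_def)

text \<open>The timelike \<open>x\<close> uses up the only negative direction of the form:
  Cauchy-Schwarz for the spatial parts forces \<open>y\<close> to have a larger spatial than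
  temporal part. This is the source of nearly all positivity below, with a point of P as
  \<open>x\<close>.\<close>

lemma mink_positive_on_orthogonal:
  assumes "x \<in> future_cone" "mink x y = 0" "y \<noteq> 0"
  shows "mink y y > 0"
proof -
  have x: "norm (fst x) < snd x" using assms by (simp add: future_cone_def)
  have eq: "fst x \<bullet> fst y = snd x * snd y" using assms by (simp add: mink_def)
  have "snd x > 0" using x by (meson norm_ge_zero order.strict_trans1)
  have le: "snd x * \<bar>snd y\<bar> \<le> norm (fst x) * norm (fst y)"
    using Cauchy_Schwarz_ineq2[of "fst x" "fst y"] \<open>snd x > 0\<close> by (simp add: eq abs_mult)
  have ne: "fst y \<noteq> 0"
    using le \<open>snd x > 0\<close> assms(3) by (auto simp: prod_eq_iff mult_le_0_iff)
  have "norm (fst x) * norm (fst y) < snd x * norm (fst y)" using x ne by simp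
  then have "snd x * \<bar>snd y\<bar> < snd x * norm (fst y)" using le by linarith
  then have "\<bar>snd y\<bar> < norm (fst y)" using \<open>snd x > 0\<close> by simp
  then have "\<bar>snd y\<bar>\<^sup>2 < (norm (fst y))\<^sup>2" by (intro power_strict_mono) auto
  then show ?thesis by (simp add: mink_def dot_square_norm flip: power2_eq_square)
qed

lemma lobachevsky_scaleR_eq:
  assumes "x \<in> lobachevsky" "c *\<^sub>R x \<in> lobachevsky"
  shows "c = 1"
proof -
  have *: "c * c = 1" "snd x > 0" "c * snd x > 0"
    using assms by (auto simp: lobachevsky_def hyperboloid_def mink_expand)
  then have "c > 0" by (simp add: zero_less_mult_iff)
  then show ?thesis using *(1) power2_eq_1_iff[of c] by (simp add: power2_eq_square)
qed

lemma closed_lobachevsky: "closed (lobachevsky :: 'n::finite pseudo_euclidean set)"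
proof -
  have eq: "(lobachevsky :: 'n pseudo_euclidean set) = {x. mink x x = -1} \<inter> {x. snd x \<ge> 0}"
  proof -
    have "snd x \<noteq> 0" if "mink x x = -1" for x :: "'n pseudo_euclidean"
      using that inner_ge_zero[of "fst x"] by (auto simp: mink_def simp del: inner_ge_zero)
    then show ?thesis by (fastforce simp: lobachevsky_def hyperboloid_def)
  qed
  show ?thesis
    unfolding eq
    by (intro closed_Int closed_Collect_eq closed_Collect_le mink.continuous_on continuous_intros)
qed

lemma mink_future_cone_neg:
  assumes "x \<in> future_cone" "y \<in> future_cone"
  shows "mink x y < 0"
proof -
  have "fst x \<bullet> fst y \<le> norm (fst x) * norm (fst y)" by (rule norm_cauchy_schwarz)
  also have "\<dots> < snd x * snd y"
    using assms norm_ge_zero by (intro mult_strict_mono') (auto simp: future_cone_def)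
  finally show ?thesis by (simp add: mink_def)
qed

lemma future_coneI:
  assumes "x \<in> future_cone" "mink x y < 0" "mink y y < 0"
  shows "y \<in> future_cone"
proof (rule ccontr)
  assume "y \<notin> future_cone"
  then have "snd y \<le> 0" using assms(3) by (simp add: future_cone_iff)
  moreover have "snd y \<noteq> 0"
    using assms(3) inner_ge_zero[of "fst y"] by (auto simp: mink_def simp del: inner_ge_zero)
  ultimately have "- y \<in> future_cone" using assms(3) by (simp add: future_cone_iff mink_expand)
  then have "mink x (- y) < 0" by (rule mink_future_cone_neg[OF assms(1)])
  then show False using assms(2) by (simp add: mink_expand)
qed

lemma future_cone_sum:
  assumes "finite B" "B \<noteq> {}" "\<And>b. b \<in> B \<Longrightarrow> b \<in> future_cone"
  shows "(\<Sum>b\<in>B. b) \<in> future_cone"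
  using assms by (induction B rule: finite_ne_induct) (auto intro: future_cone_add)

lemma open_perturbation:
  fixes x y :: "'a::real_normed_vector"
  assumes "open U" "x \<in> U"
  obtains \<epsilon> where "\<epsilon> > 0" "x + \<epsilon> *\<^sub>R y \<in> U"
proof -
  have "((\<lambda>\<epsilon>. x + \<epsilon> *\<^sub>R y) \<longlongrightarrow> x + 0 *\<^sub>R y) (at_right 0)" by (intro tendsto_intros)
  then have "eventually (\<lambda>\<epsilon>. x + \<epsilon> *\<^sub>R y \<in> U) (at_right 0)"
    using assms by (auto dest: topological_tendstoD)
  then have "eventually (\<lambda>\<epsilon>. 0 < \<epsilon> \<and> x + \<epsilon> *\<^sub>R y \<in> U) (at_right 0)"
    using eventually_at_right_less[of 0] by eventually_elim auto
  then show ?thesis using that eventually_happens' trivial_limit_at_right_real by blast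
qed

lemma sum_negative:
  fixes f :: "'a \<Rightarrow> real"
  assumes "finite A" "A \<noteq> {}" "\<And>x. x \<in> A \<Longrightarrow> f x < 0"
  shows "(\<Sum>x\<in>A. f x) < 0"
  using sum_pos[of A "\<lambda>x. - f x"] assms by (simp add: sum_negf)

lemma sum_nonpos_eq_0_iff:
  fixes f :: "'a \<Rightarrow> real"
  assumes "finite A" "\<And>x. x \<in> A \<Longrightarrow> f x \<le> 0"
  shows "(\<Sum>x\<in>A. f x) = 0 \<longleftrightarrow> (\<forall>x\<in>A. f x = 0)"
  using sum_nonneg_eq_0_iff[of A "\<lambda>x. - f x"] assms by (simp add: sum_negf)

section \<open>Numerical estimates at a vertex\<close>

text \<open>Over the region where each m_i is at least y s2 / R_i, the form m1^2 + m2^2 - 2 A m1 m2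
  is least at the corner of that region: \<open>A * R1 \<le> R2\<close> and
  \<open>A * R2 \<le> R1\<close> say that both partial derivatives are nonnegative there. Replacing
  \<open>a\<close> by its upper bound \<open>A\<close> only lowers the form.\<close>

lemma vertex_estimate:
  fixes a m1 m2 y :: real
  assumes "0 \<le> a" "a \<le> A" "0 < s2" "0 \<le> y"
    and m: "0 \<le> m1" "0 \<le> m2" "y * s2 \<le> m1 * R1" "y * s2 \<le> m2 * R2"
    and R: "0 < R1" "0 < R2" "A * R1 \<le> R2" "A * R2 \<le> R1"
    and D: "D * s2\<^sup>2 = m1\<^sup>2 + m2\<^sup>2 - 2 * a * m1 * m2"
    and k: "2 * R1\<^sup>2 * R2\<^sup>2 \<le> k * (R1\<^sup>2 + R2\<^sup>2 - 2 * A * R1 * R2)"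
  shows "2 * y\<^sup>2 \<le> k * D"
proof -
  define w where "w = y * s2"
  \<comment> \<open>The slacks of the two bounds. Expanding the form around the corner leaves a form
    in the slacks, nonnegative because A is at most 1, and terms linear in the slacks, nonnegative
    by the conditions on R1 and R2.\<close>
  define p where "p = m1 * R1 - w"
  define q where "q = m2 * R2 - w"
  have nn: "0 \<le> w" "0 \<le> p" "0 \<le> q" using assms by (auto simp: w_def p_def q_def)
  have "A * (A * R1) \<le> A * R2" using R(3) assms by (intro mult_left_mono) auto
  then have "A * A * R1 \<le> 1 * R1" using R by linarith
  then have "A * A \<le> 1" using R(1) by (rule mult_right_le_imp_le)
  then have "A\<^sup>2 \<le> 1" by (simp add: power2_eq_square)
  then have "\<bar>A\<bar> \<le> 1" using abs_square_le_1 by blast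
  then have A1: "A \<le> 1" by simp
  have "2 * A * ((p * R2) * (q * R1)) \<le> 2 * 1 * ((p * R2) * (q * R1))"
    using A1 nn R by (intro mult_right_mono) auto
  also have "\<dots> \<le> (p * R2)\<^sup>2 + (q * R1)\<^sup>2"
    using sum_squares_bound[of "p * R2" "q * R1"] by simp
  finally have pq: "0 \<le> (p * R2)\<^sup>2 + (q * R1)\<^sup>2 - 2 * A * ((p * R2) * (q * R1))" by simp
  have cross: "0 \<le> w * p * R2 * (R2 - A * R1)" "0 \<le> w * q * R1 * (R1 - A * R2)"
    using nn R by auto
  have "w\<^sup>2 * (R1\<^sup>2 + R2\<^sup>2 - 2 * A * R1 * R2)
      \<le> (w + p)\<^sup>2 * R2\<^sup>2 + (w + q)\<^sup>2 * R1\<^sup>2 - 2 * A * (w + p) * (w + q) * R1 * R2"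
    using pq cross by (simp add: power2_eq_square algebra_simps)
  also have "\<dots> = (m1\<^sup>2 + m2\<^sup>2 - 2 * A * m1 * m2) * (R1\<^sup>2 * R2\<^sup>2)"
    by (simp add: p_def q_def power2_eq_square algebra_simps)
  also have "\<dots> \<le> (m1\<^sup>2 + m2\<^sup>2 - 2 * a * m1 * m2) * (R1\<^sup>2 * R2\<^sup>2)"
    using assms by (intro mult_right_mono) (auto intro!: mult_right_mono)
  also have "\<dots> = D * s2\<^sup>2 * (R1\<^sup>2 * R2\<^sup>2)" by (simp add: D)
  finally have "y\<^sup>2 * (R1\<^sup>2 + R2\<^sup>2 - 2 * A * R1 * R2) * s2\<^sup>2 \<le> D * (R1\<^sup>2 * R2\<^sup>2) * s2\<^sup>2"
    by (simp add: w_def power_mult_distrib mult_ac)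
  then have main: "y\<^sup>2 * (R1\<^sup>2 + R2\<^sup>2 - 2 * A * R1 * R2) \<le> D * (R1\<^sup>2 * R2\<^sup>2)"
    using assms(3) by simp
  have D0: "0 \<le> D"
  proof -
    have "a \<le> 1" using assms A1 by simp
    then have "2 * a * (m1 * m2) \<le> 2 * 1 * (m1 * m2)" using m by (intro mult_right_mono) auto
    then have "0 \<le> D * s2\<^sup>2" unfolding D using sum_squares_bound[of m1 m2] by simp
    then show ?thesis using assms(3) by (simp add: zero_le_mult_iff)
  qed
  have "2 * y\<^sup>2 * (R1\<^sup>2 * R2\<^sup>2) \<le> y\<^sup>2 * (k * (R1\<^sup>2 + R2\<^sup>2 - 2 * A * R1 * R2))"
    using mult_left_mono[OF k, of "y\<^sup>2"] by (simp add: mult_ac)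
  also have "\<dots> = k * (y\<^sup>2 * (R1\<^sup>2 + R2\<^sup>2 - 2 * A * R1 * R2))" by simp
  also have "\<dots> \<le> k * (D * (R1\<^sup>2 * R2\<^sup>2))"
  proof (rule mult_left_mono[OF main])
    have "0 \<le> (R1 - R2)\<^sup>2 + 2 * (1 - A) * (R1 * R2)" using A1 R by (intro add_nonneg_nonneg) auto
    then have q0: "0 \<le> R1\<^sup>2 + R2\<^sup>2 - 2 * A * R1 * R2" by (simp add: power2_eq_square algebra_simps)
    have "0 < 2 * R1\<^sup>2 * R2\<^sup>2" using R by simp
    then have "0 < k * (R1\<^sup>2 + R2\<^sup>2 - 2 * A * R1 * R2)" using k by linarith
    with q0 show "0 \<le> k" by (simp add: zero_less_mult_iff)
  qed
  finally have "2 * y\<^sup>2 * (R1\<^sup>2 * R2\<^sup>2) \<le> k * D * (R1\<^sup>2 * R2\<^sup>2)" by simp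
  then show ?thesis using R by simp
qed

text \<open>Rational upper bounds of the cosines \<open>sqrt (k / 4)\<close> and of the corresponding sines.\<close>

definition cos_bound :: "nat \<Rightarrow> real" where
  "cos_bound k = (if k = 0 then 0 else if k = 1 then 1/2 else if k = 2 then 7072/10000 else 8661/10000)"

definition sin_bound :: "nat \<Rightarrow> real" where
  "sin_bound k = (if k = 0 then 1 else if k = 1 then 8661/10000 else if k = 2 then 7072/10000 else 1/2)"

lemma cos_bound: "a \<le> cos_bound k" if "4 * a\<^sup>2 = real k" "k < 4"
proof -
  have "k = 0 \<or> k = 1 \<or> k = 2 \<or> k = 3" using that(2) by auto
  then have "a\<^sup>2 \<le> (cos_bound k)\<^sup>2" "0 \<le> cos_bound k"
    using that(1) by (auto simp: cos_bound_def power2_eq_square)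
  then show ?thesis by (rule power2_le_imp_le)
qed

lemma sin_bound: "sqrt (1 - a\<^sup>2) \<le> sin_bound k" if "4 * a\<^sup>2 = real k" "k < 4"
proof -
  have "k = 0 \<or> k = 1 \<or> k = 2 \<or> k = 3" using that(2) by auto
  then have "1 - a\<^sup>2 \<le> (sin_bound k)\<^sup>2" "0 \<le> sin_bound k"
    using that(1) by (auto simp: sin_bound_def power2_eq_square)
  then show ?thesis by (rule real_le_lsqrt[rotated])
qed

text \<open>By the spherical law of cosines the estimated quantity is sin sin (1 + cos alpha), alpha
  being the plane angle at the vertex between the edges with dihedral angles of types
  \<open>i\<close> and \<open>j\<close>, and \<open>k\<close> the type of the third dihedral angle.
  Every summand has to be bounded from above, hence upper bounds for sines and cosines
  alike.\<close>

definition slope_bound :: "nat \<Rightarrow> nat \<Rightarrow> nat \<Rightarrow> real" where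
  "slope_bound i j k = sin_bound i * sin_bound j + cos_bound k + cos_bound i * cos_bound j"

text \<open>Since one of the cosines vanishes, \<open>1 - real (j + k) / (4 - real i)\<close> is the
  exact value of the e of the vertex, the square of the projected third normal. The exceptional type
  needs a constant of about 4.17; 3.8 is ample for the others, and the round values 3.8 and 4.2 have
  mean 4.\<close>

lemma vertex_bounds_numeric:
  "\<forall>i\<in>{0,1,2,3}. \<forall>j\<in>{0,1,2,3}. \<forall>k\<in>{0,1,2,3}. i + j + k < 4 \<longrightarrow> i = 0 \<or> j = 0 \<or> k = 0 \<longrightarrow>
     0 < slope_bound i j k \<and> 0 < slope_bound i k j \<and>
     cos_bound i * slope_bound i j k \<le> slope_bound i k j \<and>
     cos_bound i * slope_bound i k j \<le> slope_bound i j k \<and>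
     2 * (slope_bound i j k)\<^sup>2 * (slope_bound i k j)\<^sup>2
       \<le> ((if i = 2 \<and> j + k = 1 then 4.2 else 3.8) - (1 - real (j + k) / (4 - real i))) *
         ((slope_bound i j k)\<^sup>2 + (slope_bound i k j)\<^sup>2
          - 2 * cos_bound i * slope_bound i j k * slope_bound i k j)"
  by (simp add: slope_bound_def cos_bound_def sin_bound_def power2_eq_square power4_eq_xxxx)

text \<open>The arguments \<open>a\<close>, \<open>b\<close>, \<open>c\<close> are the cosines of the dihedral angles at a vertex. The value
  \<open>K\<close> exceeds \<open>3.8\<close> only for angles \<open>\<pi>/4\<close>, \<open>\<pi>/2\<close>, \<open>\<pi>/3\<close> with \<open>\<pi>/4\<close> at the edge considered.\<close>

lemma crystallographic_vertex_bound:
  fixes a b c m1 m2 y :: real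
  assumes pos: "0 \<le> a" "0 \<le> b" "0 \<le> c" "0 \<le> y" "0 \<le> m1" "0 \<le> m2"
    and int: "4 * a\<^sup>2 = real i" "4 * b\<^sup>2 = real j" "4 * c\<^sup>2 = real k"
    and less: "a\<^sup>2 + b\<^sup>2 + c\<^sup>2 + 2 * a * b * c < 1"
    and y1: "y * (1 - a\<^sup>2) \<le> m1 * (sqrt (1 - a\<^sup>2) * sqrt (1 - b\<^sup>2) + c + a * b)"
    and y2: "y * (1 - a\<^sup>2) \<le> m2 * (sqrt (1 - a\<^sup>2) * sqrt (1 - c\<^sup>2) + b + a * c)"
    and D: "D * (1 - a\<^sup>2)\<^sup>2 = m1\<^sup>2 + m2\<^sup>2 - 2 * a * m1 * m2"
  shows "\<exists>K. 2 * y\<^sup>2 \<le> (K - (1 - (b\<^sup>2 + c\<^sup>2 + 2 * a * b * c) / (1 - a\<^sup>2))) * D \<and> 2 \<le> K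
           \<and> (K \<le> 3.8 \<or> K \<le> 4.2 \<and> a\<^sup>2 = 1/2 \<and> (b = 0 \<and> c = 1/2 \<or> b = 1/2 \<and> c = 0))"
proof -
  have abc0: "0 \<le> 2 * a * b * c" using pos by simp
  have "real (i + j + k) < real 4" using less int abc0 by simp
  then have ijk: "i + j + k < 4" unfolding of_nat_less_iff .
  have half: "1/2 \<le> z" if "4 * z\<^sup>2 = real l" "l \<noteq> 0" "0 \<le> z" for z l
  proof (rule power2_le_imp_le)
    show "(1/2)\<^sup>2 \<le> z\<^sup>2" using that by (simp add: power2_eq_square)
  qed (use that in auto)
  \<comment> \<open>Without a right angle all three cosines are at least 1/2, and a^2 + b^2 + c^2 +
    2abc is at least 3/4 + 1/4 = 1.\<close>
  have zero: "i = 0 \<or> j = 0 \<or> k = 0"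
  proof (rule ccontr)
    assume "\<not> ?thesis"
    then have nz: "i \<noteq> 0" "j \<noteq> 0" "k \<noteq> 0" by auto
    then have "1/2 \<le> a" "1/2 \<le> b" "1/2 \<le> c" using half int pos by blast+
    then have "(1/2) * (1/2) * (1/2) \<le> a * b * c" by (intro mult_mono) auto
    moreover have "1 \<le> real i" "1 \<le> real j" "1 \<le> real k" using nz by auto
    ultimately show False using less int by linarith
  qed
  then have abc: "a * b * c = 0" "i * j * k = 0" using int by auto
  have s2: "1 - a\<^sup>2 = (4 - real i) / 4" using int by simp
  have s2pos: "1 - a\<^sup>2 > 0" using ijk unfolding s2 by simp
  define A where "A = cos_bound i"
  define B where "B = cos_bound j"
  define C where "C = cos_bound k"
  have ub: "a \<le> A" "b \<le> B" "c \<le> C" "sqrt (1 - a\<^sup>2) \<le> sin_bound i" "sqrt (1 - b\<^sup>2) \<le> sin_bound j"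
    "sqrt (1 - c\<^sup>2) \<le> sin_bound k"
    unfolding A_def B_def C_def using int ijk by (auto intro!: cos_bound sin_bound)
  have sq1: "a\<^sup>2 \<le> 1" "b\<^sup>2 \<le> 1" "c\<^sup>2 \<le> 1" using int ijk by linarith+
  define R1 where "R1 = slope_bound i j k"
  define R2 where "R2 = slope_bound i k j"
  have "sqrt (1 - a\<^sup>2) * sqrt (1 - b\<^sup>2) + c + a * b \<le> R1"
    unfolding R1_def slope_bound_def C_def[symmetric] A_def[symmetric] B_def[symmetric]
    using ub pos sq1 by (intro add_mono mult_mono) (auto simp: sin_bound_def A_def cos_bound_def)
  then have y1': "y * (1 - a\<^sup>2) \<le> m1 * R1" using y1 pos by (meson mult_left_mono order_trans)
  have "sqrt (1 - a\<^sup>2) * sqrt (1 - c\<^sup>2) + b + a * c \<le> R2"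
    unfolding R2_def slope_bound_def C_def[symmetric] A_def[symmetric] B_def[symmetric]
    using ub pos sq1 by (intro add_mono mult_mono) (auto simp: sin_bound_def A_def cos_bound_def)
  then have y2': "y * (1 - a\<^sup>2) \<le> m2 * R2" using y2 pos by (meson mult_left_mono order_trans)
  define K where "K = (if i = 2 \<and> j + k = 1 then 4.2 else 3.8 :: real)"
  define e where "e = 1 - real (j + k) / (4 - real i)"
  have e: "1 - (b\<^sup>2 + c\<^sup>2 + 2 * a * b * c) / (1 - a\<^sup>2) = e"
  proof -
    have "2 * a * b * c = 0" using abc(1) by auto
    moreover have "b\<^sup>2 + c\<^sup>2 + 0 = real (j + k) / 4" using int by simp
    ultimately have "b\<^sup>2 + c\<^sup>2 + 2 * a * b * c = real (j + k) / 4" by presburger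
    then show ?thesis unfolding e_def s2 by simp
  qed
  have "i \<in> {0,1,2,3}" "j \<in> {0,1,2,3}" "k \<in> {0,1,2,3}" using ijk by auto
  then have "0 < R1 \<and> 0 < R2 \<and> A * R1 \<le> R2 \<and> A * R2 \<le> R1 \<and>
      2 * R1\<^sup>2 * R2\<^sup>2 \<le> (K - e) * (R1\<^sup>2 + R2\<^sup>2 - 2 * A * R1 * R2)"
    using vertex_bounds_numeric ijk zero unfolding R1_def R2_def K_def e_def A_def B_def C_def
    by blast
  then have "2 * y\<^sup>2 \<le> (K - e) * D"
    using vertex_estimate[OF pos(1) ub(1) s2pos pos(4,5,6) y1' y2' _ _ _ _ D] by blast
  moreover have "2 \<le> K" by (simp add: K_def)
  moreover have "K \<le> 3.8 \<or> K \<le> 4.2 \<and> a\<^sup>2 = 1/2 \<and> (b = 0 \<and> c = 1/2 \<or> b = 1/2 \<and> c = 0)"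
  proof (cases "i = 2 \<and> j + k = 1")
    case True
    have root: "z = 1/2" if "4 * z\<^sup>2 = real 1" "0 \<le> z" for z :: real
    proof -
      have "z\<^sup>2 = (1/2)\<^sup>2" using that by (simp add: power2_eq_square)
      then show ?thesis using that by (simp add: power2_eq_iff_nonneg)
    qed
    have "j = 0 \<and> k = 1 \<or> j = 1 \<and> k = 0" using True by auto
    then show ?thesis using True int pos root by (auto simp: K_def)
  next
    case False
    then have "K = 3.8" unfolding K_def by (simp only: if_False)
    then show ?thesis by simp
  qed
  ultimately show ?thesis unfolding e by blast
qed

text \<open>The arithmetic-geometric mean inequality, applied to the two factors on the right of the
  hypothesis on \<open>Z\<close> and to \<open>y * y'\<close>, gives Z N <= (e + e') N / 2 + y^2 +
  y'^2 with N = 1 + D. Inserting the bounds for y and y' cancels e and e'.\<close>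

lemma width_less:
  fixes a :: real
  assumes pos: "0 \<le> a" "a < 1" "0 \<le> b" "0 \<le> c" "0 \<le> b'" "0 \<le> c'" "0 \<le> D"
    and e: "e = 1 - (b\<^sup>2 + c\<^sup>2 + 2 * a * b * c) / (1 - a\<^sup>2)" "0 \<le> e"
    and e': "e' = 1 - (b'\<^sup>2 + c'\<^sup>2 + 2 * a * b' * c') / (1 - a\<^sup>2)" "0 \<le> e'"
    and y: "\<exists>K. 2 * y\<^sup>2 \<le> (K - e) * D \<and> 2 \<le> K
           \<and> (K \<le> 3.8 \<or> K \<le> 4.2 \<and> a\<^sup>2 = 1/2 \<and> (b = 0 \<and> c = 1/2 \<or> b = 1/2 \<and> c = 0))"
    and y': "\<exists>K. 2 * y'\<^sup>2 \<le> (K - e') * D \<and> 2 \<le> K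
           \<and> (K \<le> 3.8 \<or> K \<le> 4.2 \<and> a\<^sup>2 = 1/2 \<and> (b' = 0 \<and> c' = 1/2 \<or> b' = 1/2 \<and> c' = 0))"
    and Z: "(Z * (1 + D) - y * y')\<^sup>2 = (e * (1 + D) + y\<^sup>2) * (e' * (1 + D) + y'\<^sup>2)"
    and Zeq: "Z = T + (b * b' + c * c' + a * (b * c' + c * b')) / (1 - a\<^sup>2)"
  shows "T < 4.14"
proof -
  obtain K where K: "2 * y\<^sup>2 \<le> (K - e) * D" "2 \<le> K"
    "K \<le> 3.8 \<or> K \<le> 4.2 \<and> a\<^sup>2 = 1/2 \<and> (b = 0 \<and> c = 1/2 \<or> b = 1/2 \<and> c = 0)" using y by blast
  obtain K' where K': "2 * y'\<^sup>2 \<le> (K' - e') * D" "2 \<le> K'"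
    "K' \<le> 3.8 \<or> K' \<le> 4.2 \<and> a\<^sup>2 = 1/2 \<and> (b' = 0 \<and> c' = 1/2 \<or> b' = 1/2 \<and> c' = 0)" using y' by blast
  define N where "N = 1 + D"
  have N: "N > 0" using pos by (simp add: N_def)
  have s2: "1 - a\<^sup>2 > 0" using pos by (simp add: power_less_one_iff abs_square_less_1)
  have "e \<le> 1" "e' \<le> 1" unfolding e e' using pos s2 by (auto intro!: divide_nonneg_pos add_nonneg_nonneg)
  \<comment> \<open>D may be enlarged to N = 1 + D because the coefficients \<open>K - e\<close> and
    \<open>K' - e'\<close> are nonnegative, K and K' being at least 2 and e and e' at most
    1.\<close>
  then have "2 * y\<^sup>2 \<le> (K - e) * N" "2 * y'\<^sup>2 \<le> (K' - e') * N"
    using K K' by (auto simp: N_def algebra_simps)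
  then have yy: "y\<^sup>2 + y'\<^sup>2 \<le> (K + K' - e - e') * N / 2" by (simp add: algebra_simps)
  define u where "u = e * N + y\<^sup>2"
  define v where "v = e' * N + y'\<^sup>2"
  have uv: "0 \<le> u" "0 \<le> v" using N e(2) e'(2) by (auto simp: u_def v_def)
  have "0 \<le> (u - v)\<^sup>2" by simp
  then have "u * v \<le> ((u + v) / 2)\<^sup>2" by (simp add: power2_eq_square field_simps)
  then have "(Z * N - y * y')\<^sup>2 \<le> ((u + v) / 2)\<^sup>2" using Z by (simp add: N_def u_def v_def)
  then have "Z * N - y * y' \<le> (u + v) / 2" by (rule power2_le_imp_le) (use uv in auto)
  moreover have "y * y' \<le> (y\<^sup>2 + y'\<^sup>2) / 2" using sum_squares_bound[of y y'] by simp
  ultimately have "Z * N \<le> (e + e') * N / 2 + (y\<^sup>2 + y'\<^sup>2)" by (simp add: u_def v_def field_simps)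
  also have "\<dots> \<le> (K + K') / 2 * N" using yy by (simp add: field_simps)
  finally have ZK: "Z \<le> (K + K') / 2" using N by simp
  have p0: "0 \<le> (b * b' + c * c' + a * (b * c' + c * b')) / (1 - a\<^sup>2)"
    using pos s2 by (intro divide_nonneg_pos add_nonneg_nonneg mult_nonneg_nonneg) auto
  define pp where "pp = (b * b' + c * c' + a * (b * c' + c * b')) / (1 - a\<^sup>2)"
  have Zpp: "Z = T + pp" using Zeq by (simp add: pp_def)
  show ?thesis
  proof (cases "K \<le> 3.8 \<or> K' \<le> 3.8")
    case True
    then have "K + K' \<le> 8" using K(3) K'(3) by auto
    then show ?thesis using ZK Zpp p0 unfolding pp_def[symmetric] by simp
  next
    case False
    then have sp: "K \<le> 4.2" "K' \<le> 4.2" "a\<^sup>2 = 1/2" "b = 0 \<and> c = 1/2 \<or> b = 1/2 \<and> c = 0"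
      "b' = 0 \<and> c' = 1/2 \<or> b' = 1/2 \<and> c' = 0" using K(3) K'(3) by auto
    have "1/2 \<le> a" by (rule power2_le_imp_le) (use sp pos in \<open>auto simp: power2_eq_square\<close>)
    \<comment> \<open>If the two angles pi/3 belong to the same face through the edge, b b' + c c'
      is 1/4; otherwise a (b c' + c b') is a/4. Division by 1 - a^2 = 1/2 then gives the 1/4 that
      lowers 4.2 sufficiently.\<close>
    then have "1/8 \<le> b * b' + c * c' + a * (b * c' + c * b')" using sp(4,5)
      by (elim disjE conjE) (simp_all only: mult_zero_left mult_zero_right, simp_all)
    then have "1/4 \<le> pp" using sp(3) by (simp add: pp_def)
    then show ?thesis using ZK Zpp sp by simp
  qed
qed

section \<open>Compact acute-angled polyhedra\<close>

text \<open>\<open>W\<close> consists of outer normals, one for each facet: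
  \<open>wall_point\<close> makes every wall irredundant by a point on it and on no other. The sign
  condition \<open>acute\<close> is imposed also on walls that do not meet; for chambers of a
  reflection group it holds in this strength.\<close>

locale acute_polyhedron =
  fixes W P :: "3 pseudo_euclidean set" and q :: "3 pseudo_euclidean"
  assumes finite_walls: "finite W"
    and unit: "e \<in> W \<Longrightarrow> mink e e = 1"
    and P_eq: "P = {x \<in> lobachevsky. \<forall>e\<in>W. mink e x \<le> 0}"
    and q: "q \<in> lobachevsky"
    and q_neg: "e \<in> W \<Longrightarrow> mink e q < 0"
    and wall_point: "e \<in> W \<Longrightarrow> \<exists>x\<in>P. mink e x = 0 \<and> (\<forall>e'\<in>W - {e}. mink e' x < 0)"
    and acute: "e \<in> W \<Longrightarrow> e' \<in> W \<Longrightarrow> e \<noteq> e' \<Longrightarrow> mink e e' \<le> 0"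
    and bounded_P: "bounded P"
begin

definition active :: "3 pseudo_euclidean \<Rightarrow> 3 pseudo_euclidean set" where
  "active v = {e \<in> W. mink e v = 0}"

definition face :: "3 pseudo_euclidean set \<Rightarrow> 3 pseudo_euclidean set" where
  "face A = {x \<in> P. \<forall>e\<in>A. mink e x = 0}"

lemma q_in_P: "q \<in> P"
  using q q_neg by (auto simp: P_eq intro: less_imp_le)

lemma P_nonpos: "x \<in> P \<Longrightarrow> e \<in> W \<Longrightarrow> mink e x \<le> 0"
  by (simp add: P_eq)

lemma P_lobachevsky: "x \<in> P \<Longrightarrow> x \<in> lobachevsky"
  by (simp add: P_eq)

lemma P_future: "x \<in> P \<Longrightarrow> x \<in> future_cone"
  using P_lobachevsky lobachevsky_subset_future_cone by blast

lemma mink_self: "x \<in> P \<Longrightarrow> mink x x = -1"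
  using P_lobachevsky by (auto simp: lobachevsky_def hyperboloid_def)

lemma finite_active: "finite (active v)"
  using finite_walls by (simp add: active_def)

lemma normalize_in_P:
  assumes "x \<in> future_cone" "\<And>e. e \<in> W \<Longrightarrow> mink e x \<le> 0"
  obtains s where "s > 0" "s *\<^sub>R x \<in> P"
proof -
  obtain s where s: "s > 0" "normalize_point x = s *\<^sub>R x" "normalize_point x \<in> lobachevsky"
    using normalize_pointE[OF assms(1)] .
  then show ?thesis using assms(2)
    by (intro that[of s]) (auto simp: P_eq mink_expand mult_le_0_iff)
qed

text \<open>A linear relation between the active normals splits into two equal nonnegative combinations
  whose product is nonpositive; hence both vanish, and pairing with \<open>q\<close> kills the coefficients.\<close>

lemma independent_active:
  assumes v: "v \<in> P"
  shows "independent (active v)"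
proof -
  have "c e = 0" if c: "(\<Sum>e\<in>active v. c e *\<^sub>R e) = 0" and e: "e \<in> active v" for c e
  proof -
    define A where "A = active v"
    define p where "p = {e \<in> A. c e > 0}"
    define n where "n = {e \<in> A. c e < 0}"
    have A: "finite A" "A \<subseteq> W" "p \<subseteq> A" "n \<subseteq> A"
      using finite_walls by (auto simp: A_def p_def n_def active_def)
    have fin: "finite p" "finite n" using A finite_subset by blast+
    define z where "z = (\<Sum>e\<in>p. c e *\<^sub>R e)"
    have "(\<Sum>e\<in>A. c e *\<^sub>R e) = (\<Sum>e\<in>p \<union> n. c e *\<^sub>R e)"
      using A by (intro sum.mono_neutral_right) (auto simp: p_def n_def)
    also have "\<dots> = z + (\<Sum>e\<in>n. c e *\<^sub>R e)"
      unfolding z_def using fin by (intro sum.union_disjoint) (auto simp: p_def n_def)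
    finally have zn: "z = (\<Sum>e\<in>n. (- c e) *\<^sub>R e)"
      using c by (simp add: A_def sum_negf eq_neg_iff_add_eq_0)
    have "mink z z = mink (\<Sum>e\<in>p. c e *\<^sub>R e) (\<Sum>e\<in>n. (- c e) *\<^sub>R e)"
      using zn z_def by simp
    also have "\<dots> = (\<Sum>e\<in>p. \<Sum>e'\<in>n. (c e * - c e') * mink e e')"
      unfolding mink.sum_left by (simp add: mink.sum_right mink_expand sum_distrib_left mult_ac)
    also have "\<dots> \<le> 0"
    proof (intro sum_nonpos mult_nonneg_nonpos)
      fix e e' assume "e \<in> p" "e' \<in> n"
      then have "e \<noteq> e'" "e \<in> W" "e' \<in> W" using A by (auto simp: p_def n_def)
      then show "mink e e' \<le> 0" by (intro acute)
    qed (auto simp: p_def n_def mult_nonneg_nonpos)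
    finally have zz: "mink z z \<le> 0" .
    have "mink v z = 0"
      unfolding z_def mink.sum_right
      using A by (intro sum.neutral) (auto simp: p_def A_def active_def mink_expand mink_commute[of v])
    then have z0: "z = 0"
      using mink_positive_on_orthogonal[OF P_future[OF v], of z] zz by linarith
    have neg: "mink e q < 0" if "e \<in> A" for e using that A q_neg by blast
    have "p = {}"
    proof (rule ccontr)
      assume "p \<noteq> {}"
      then have "(\<Sum>e\<in>p. c e * mink e q) < 0"
        using fin neg A by (intro sum_negative) (auto simp: p_def mult_pos_neg)
      moreover have "(\<Sum>e\<in>p. c e * mink e q) = mink z q"
        by (simp add: z_def mink.sum_left mink_expand)
      ultimately show False using z0 by (simp add: mink.zero_left)
    qed
    moreover have "n = {}"
    proof (rule ccontr)
      assume "n \<noteq> {}"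
      then have "(\<Sum>e\<in>n. - c e * mink e q) < 0"
        using fin neg A by (intro sum_negative) (auto simp: n_def mult_neg_neg)
      moreover have "(\<Sum>e\<in>n. - c e * mink e q) = mink z q"
        by (simp add: zn mink.sum_left mink_expand)
      ultimately show False using z0 by (simp add: mink.zero_left)
    qed
    ultimately have "e \<notin> p" "e \<notin> n" by simp_all
    then show ?thesis using e by (simp add: p_def n_def A_def)
  qed
  then show ?thesis using finite_active by (auto simp: dependent_finite)
qed

lemma card_active_le: "v \<in> P \<Longrightarrow> card (active v) \<le> 3"
proof -
  assume v: "v \<in> P"
  have "v \<noteq> 0" using mink_self[OF v] by (auto simp: mink.zero_left)
  then have "dim {x. mink v x = 0} = 3" by (simp add: dim_mink_orthogonal)
  moreover have "active v \<subseteq> {x. mink v x = 0}" by (auto simp: active_def mink_commute)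
  ultimately show ?thesis
    using independent_card_le_dim[OF _ independent_active[OF v]] by metis
qed

text \<open>If the ray met no wall before reaching the light cone, its central projection to the
  hyperboloid would be an unbounded curve inside P. Hence some wall is met in time, and the first
  one met is the exit. Active walls are never met, as the direction \<open>d\<close> does not
  increase their products.\<close>

lemma ray_exit:
  assumes v: "v \<in> P" and d: "mink v d = 0" "d \<noteq> 0" and ad: "\<And>e. e \<in> active v \<Longrightarrow> mink e d \<le> 0"
  obtains s t e where "s > 0" "t > 0" "s *\<^sub>R (v + t *\<^sub>R d) \<in> P" "e \<in> W" "mink e v < 0"
    "mink e (v + t *\<^sub>R d) = 0"
proof -
  have dd: "mink d d > 0" using mink_positive_on_orthogonal[OF P_future[OF v] d] .
  have vd: "mink v (v + t *\<^sub>R d) = -1" "mink (v + t *\<^sub>R d) (v + t *\<^sub>R d) = t\<^sup>2 * mink d d - 1" for t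
    using d mink_self[OF v] by (auto simp: mink_expand mink_commute[of d v] power2_eq_square)
  have cone: "v + t *\<^sub>R d \<in> future_cone" if "t\<^sup>2 * mink d d < 1" for t
    using that by (intro future_coneI[OF P_future[OF v]]) (simp_all add: vd)
  define F where "F = {e \<in> W. mink e d > 0}"
  define \<tau> where "\<tau> e = - mink e v / mink e d" for e
  have F: "finite F" using finite_walls by (simp add: F_def)
  have Fv: "mink e v < 0" if "e \<in> F" for e
  proof -
    have "mink e v \<noteq> 0" using that ad[of e] by (auto simp: F_def active_def)
    then show ?thesis using P_nonpos[OF v, of e] that by (simp add: F_def)
  qed
  have \<tau>pos: "\<tau> e > 0" if "e \<in> F" for e
    using Fv[OF that] that by (simp add: \<tau>_def F_def divide_neg_pos)
  have ok: "mink e (v + t *\<^sub>R d) \<le> 0" if "e \<in> W" "0 \<le> t" "\<And>e. e \<in> F \<Longrightarrow> t \<le> \<tau> e" for e t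
  proof (cases "e \<in> F")
    case True
    then have "t * mink e d \<le> - mink e v"
      using that(3)[OF True] by (simp add: \<tau>_def F_def field_simps)
    then show ?thesis by (simp add: mink_expand)
  next
    case False
    then have "t * mink e d \<le> 0" using that by (auto simp: F_def mult_le_0_iff)
    then show ?thesis using P_nonpos[OF v that(1)] by (simp add: mink_expand)
  qed
  have "\<exists>e\<in>F. (\<tau> e)\<^sup>2 * mink d d < 1"
  proof (rule ccontr)
    assume "\<not> ?thesis"
    then have far: "1 \<le> (\<tau> e)\<^sup>2 * mink d d" if "e \<in> F" for e using that by fastforce
    obtain R where R: "\<And>x. x \<in> P \<Longrightarrow> norm x \<le> R" using bounded_P by (auto simp: bounded_iff)
    obtain K where K: "\<And>x y :: 3 pseudo_euclidean. norm (mink x y) \<le> norm x * norm y * K" "0 < K"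
      using mink.pos_bounded by blast
    define M where "M = norm v * R * K + 1"
    have "0 \<le> R" using R[OF v] norm_ge_zero order_trans by blast
    then have M: "M > 0" using K(2) by (simp add: M_def add_nonneg_pos)
    \<comment> \<open>Chosen so that normalising the point \<open>v + t *\<^sub>R d\<close>
      multiplies it by exactly M + 1. This factor is also the absolute product of \<open>v\<close>
      with a point of P, which boundedness of P keeps below M.\<close>
    define t where "t = sqrt ((1 - 1 / (M + 1)\<^sup>2) / mink d d)"
    have "1 \<le> (M + 1)\<^sup>2" using M by (intro one_le_power) simp
    then have m1: "0 \<le> 1 - 1 / (M + 1)\<^sup>2" using M by (simp add: divide_le_eq)
    then have t2: "t\<^sup>2 * mink d d = 1 - 1 / (M + 1)\<^sup>2" using dd by (simp add: t_def)
    have t0: "0 \<le> t" using m1 dd by (simp add: t_def)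
    have lt: "t\<^sup>2 * mink d d < 1" using M by (simp add: t2)
    have "t \<le> \<tau> e" if "e \<in> F" for e
    proof (rule power2_le_imp_le)
      have "t\<^sup>2 * mink d d \<le> (\<tau> e)\<^sup>2 * mink d d" using lt far[OF that] by linarith
      then show "t\<^sup>2 \<le> (\<tau> e)\<^sup>2" using dd by simp
    qed (use \<tau>pos[OF that] in simp)
    then obtain s where s: "s > 0" "s *\<^sub>R (v + t *\<^sub>R d) \<in> P"
      using normalize_in_P[OF cone[OF lt]] ok t0 by metis
    have "s\<^sup>2 * mink (v + t *\<^sub>R d) (v + t *\<^sub>R d) = -1"
      using mink_self[OF s(2)] unfolding mink.scaleR_left mink.scaleR_right
      by (simp add: power2_eq_square)
    then have "s\<^sup>2 * (1 / (M + 1)\<^sup>2) = 1"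
    proof -
      have "mink (v + t *\<^sub>R d) (v + t *\<^sub>R d) = - (1 / (M + 1)\<^sup>2)" unfolding vd t2 by simp
      with \<open>s\<^sup>2 * mink (v + t *\<^sub>R d) (v + t *\<^sub>R d) = -1\<close> show ?thesis
        by (simp only: mult_minus_right neg_equal_iff_equal)
    qed
    then have "s\<^sup>2 = (M + 1)\<^sup>2" using M by (auto simp: field_simps)
    then have sM: "s = M + 1" using s(1) M by (simp add: power2_eq_iff_nonneg)
    have "s = \<bar>mink v (s *\<^sub>R (v + t *\<^sub>R d))\<bar>"
      using s(1) vd(1)[of t] by (simp add: mink.scaleR_right)
    also have "\<dots> \<le> norm v * norm (s *\<^sub>R (v + t *\<^sub>R d)) * K" using K(1) by (metis real_norm_def)
    also have "\<dots> \<le> norm v * R * K"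
      using R[OF s(2)] K(2) by (intro mult_right_mono mult_left_mono) auto
    finally show False using sM by (simp add: M_def)
  qed
  then obtain e1 where e1: "e1 \<in> F" "(\<tau> e1)\<^sup>2 * mink d d < 1" by blast
  define t where "t = Min (\<tau> ` F)"
  have "t \<in> \<tau> ` F" unfolding t_def using F e1 by (intro Min_in) auto
  then obtain e where e: "e \<in> F" "t = \<tau> e" by blast
  have tle: "t \<le> \<tau> e" if "e \<in> F" for e unfolding t_def using that F by simp
  have t0: "0 < t" using \<tau>pos e by simp
  have "t\<^sup>2 * mink d d \<le> (\<tau> e1)\<^sup>2 * mink d d"
    using tle[OF e1(1)] t0 dd by (intro mult_right_mono power_mono) auto
  then have "t\<^sup>2 * mink d d < 1" using e1 by linarith
  then obtain s where s: "s > 0" "s *\<^sub>R (v + t *\<^sub>R d) \<in> P"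
    using normalize_in_P[OF cone] ok t0 tle by (metis less_imp_le)
  have "mink e (v + t *\<^sub>R d) = 0" using e by (simp add: mink_expand \<tau>_def F_def)
  moreover have "e \<in> W" using e(1) by (simp add: F_def)
  ultimately show ?thesis using that[OF s(1) t0 s(2) _ Fv[OF e(1)]] by blast
qed

text \<open>Take a point on as many walls as possible. With fewer than three, a direction orthogonal
  to the point and to all active normals still exists in dimension 4; following it to its exit keeps
  the old walls and adds one.\<close>

lemma vertex_exists: "\<exists>v\<in>P. card (active v) = 3"
proof -
  obtain v where v: "v \<in> P" "\<And>w. w \<in> P \<Longrightarrow> card (active w) \<le> card (active v)"
    using ex_has_greatest_nat[of "\<lambda>x. x \<in> P" q "\<lambda>x. card (active x)" 4] q_in_P card_active_le
    by fastforce
  have "card (active v) \<ge> 3"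
  proof (rule ccontr)
    assume "\<not> ?thesis"
    then have "card (insert v (active v)) \<le> CARD(3)"
      using card_insert_le_m1[of 3 "active v" v] by simp
    then obtain d where d: "d \<noteq> 0" "\<And>a. a \<in> insert v (active v) \<Longrightarrow> mink a d = 0"
      using mink_orthogonal_exists finite_active by (metis finite_insert)
    then obtain s t e where e: "s > 0" "t > 0" "s *\<^sub>R (v + t *\<^sub>R d) \<in> P" "e \<in> W" "mink e v < 0"
      "mink e (v + t *\<^sub>R d) = 0"
      using ray_exit[OF v(1), of d] by (metis insertI1 insertI2 order_refl)
    have "insert e (active v) \<subseteq> active (s *\<^sub>R (v + t *\<^sub>R d))"
      using e d(2) by (auto simp: active_def mink_expand)
    moreover have "e \<notin> active v" using e by (simp add: active_def)
    ultimately have "card (active v) < card (active (s *\<^sub>R (v + t *\<^sub>R d)))"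
      using finite_active by (metis Suc_le_lessD card_insert_disjoint card_mono)
    then show False using v(2)[OF e(3)] by simp
  qed
  then show ?thesis using v card_active_le[OF v(1)] by (intro bexI[of _ v]) auto
qed

text \<open>The sum of the normals in \<open>A\<close> is nonpositive on P and vanishes exactly
  where all of them do. It is nonzero by its product with \<open>q\<close>, and spacelike because it
  is orthogonal to \<open>v\<close>, so it can be normalised.\<close>

lemma unit_outer_normal_face:
  assumes "A \<subseteq> W" "A \<noteq> {}" "A \<subseteq> active v" "v \<in> P"
  shows "\<exists>u. unit_outer_normal P (face A) u"
proof -
  define z where "z = (\<Sum>e\<in>A. e)"
  have fin: "finite A" using assms(1) finite_walls finite_subset by blast
  have z: "mink z x = (\<Sum>e\<in>A. mink e x)" for x by (simp add: z_def mink.sum_left)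
  have "(\<Sum>e\<in>A. mink e q) < 0" using fin assms q_neg by (intro sum_negative) auto
  then have "z \<noteq> 0" using z[of q] by (auto simp: mink.zero_left)
  moreover have "mink v z = 0"
    unfolding mink_commute[of v] z using assms by (intro sum.neutral) (auto simp: active_def)
  ultimately have zz: "mink z z > 0"
    using mink_positive_on_orthogonal[OF P_future[OF assms(4)]] by blast
  define r where "r = 1 / sqrt (mink z z)"
  have r: "r > 0" "r * r * mink z z = 1" using zz by (auto simp: r_def)
  have "unit_outer_normal P (face A) (r *\<^sub>R z)"
    unfolding unit_outer_normal_def
  proof (intro conjI ballI)
    show "mink (r *\<^sub>R z) (r *\<^sub>R z) = 1" using r by (simp add: mink_expand)
    show "mink (r *\<^sub>R z) x \<le> 0" if "x \<in> P" for x
    proof -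
      have "mink z x \<le> 0" unfolding z using P_nonpos[OF that] assms(1) by (intro sum_nonpos) auto
      then show ?thesis using r by (simp add: mink_expand mult_le_0_iff)
    qed
    have "mink z x = 0 \<longleftrightarrow> (\<forall>e\<in>A. mink e x = 0)" if "x \<in> P" for x
      unfolding z using P_nonpos[OF that] assms(1) fin
      by (intro sum_nonpos_eq_0_iff) auto
    then show "face A = P \<inter> hyperplane (r *\<^sub>R z)"
      using r P_lobachevsky by (auto simp: face_def hyperplane_def mink_expand)
  qed
  then show ?thesis by blast
qed

end

section \<open>Facets of the polyhedron and their normals\<close>

context acute_polyhedron
begin

text \<open>From a point of the facet strictly inside all other walls, a small step in any direction
  of the hyperplane stays, after normalisation, in the facet.\<close>

lemma span_wall:
  assumes e: "e \<in> W"
  shows "span (face {e}) = {x. mink e x = 0}"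
proof (intro equalityI span_minimal subspace_mink_orthogonal)
  show "face {e} \<subseteq> {x. mink e x = 0}" by (auto simp: face_def)
  show "{x. mink e x = 0} \<subseteq> span (face {e})"
  proof
    fix y assume "y \<in> {x. mink e x = 0}"
    then have y: "mink e y = 0" by simp
    obtain x where x: "x \<in> P" "mink e x = 0" "\<And>e'. e' \<in> W - {e} \<Longrightarrow> mink e' x < 0"
      using wall_point[OF e] by blast
    define U where "U = future_cone \<inter> (\<Inter>e'\<in>W - {e}. {x. mink e' x < 0})"
    have "open U" unfolding U_def
      using finite_walls
      by (intro open_Int open_future_cone open_INT ballI open_Collect_less mink.continuous_on continuous_intros) auto
    moreover have "x \<in> U" using x P_future by (auto simp: U_def)
    ultimately obtain \<epsilon> where \<epsilon>: "\<epsilon> > 0" "x + \<epsilon> *\<^sub>R y \<in> U" by (rule open_perturbation)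
    have z0: "mink e (x + \<epsilon> *\<^sub>R y) = 0" using x y by (simp add: mink_expand)
    have "mink e' (x + \<epsilon> *\<^sub>R y) \<le> 0" if "e' \<in> W" for e'
      using \<epsilon>(2) z0 that by (cases "e' = e") (auto simp: U_def intro: less_imp_le)
    then obtain s where s: "s > 0" "s *\<^sub>R (x + \<epsilon> *\<^sub>R y) \<in> P"
      using normalize_in_P[of "x + \<epsilon> *\<^sub>R y"] \<epsilon>(2) unfolding U_def by blast
    have "s *\<^sub>R (x + \<epsilon> *\<^sub>R y) \<in> face {e}" "x \<in> face {e}"
      using s z0 x by (auto simp: face_def mink.scaleR_right)
    then have sp: "s *\<^sub>R (x + \<epsilon> *\<^sub>R y) \<in> span (face {e})" "x \<in> span (face {e})"
      by (auto intro: span_base)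
    have "(1 / s) *\<^sub>R (s *\<^sub>R (x + \<epsilon> *\<^sub>R y)) \<in> span (face {e})" by (rule span_scale[OF sp(1)])
    then have "x + \<epsilon> *\<^sub>R y \<in> span (face {e})" using s by simp
    from span_scale[OF span_diff[OF this sp(2)], of "1 / \<epsilon>"]
    show "y \<in> span (face {e})" using \<epsilon> by simp
  qed
qed

lemma is_face_wall:
  assumes e: "e \<in> W"
  shows "is_face P (face {e})"
proof -
  obtain x where x: "x \<in> P" "mink e x = 0" using wall_point[OF e] by blast
  have "\<exists>u. unit_outer_normal P (face {e}) u"
    by (rule unit_outer_normal_face[of _ x]) (use e x in \<open>auto simp: active_def\<close>)
  moreover have "e \<noteq> 0" using unit[OF e] by (auto simp: mink.zero_left)
  then have "dim (span (face {e})) = 3"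
    unfolding span_wall[OF e] by (simp add: dim_mink_orthogonal)
  ultimately show ?thesis by (simp add: is_face_def dim_face_def)
qed

lemma unit_outer_normal_wall:
  assumes e: "e \<in> W"
  shows "unit_outer_normal P (face {e}) e"
  using unit[OF e] P_nonpos[OF _ e] P_lobachevsky
  by (auto simp: unit_outer_normal_def face_def hyperplane_def)

text \<open>\<open>edge_width\<close> speaks of arbitrary faces with arbitrary unit outer normals;
  this brings them back to \<open>W\<close>. The sum \<open>s\<close> of a basis of the face lies on
  some wall, for otherwise P would reach beyond the supporting hyperplane. That wall contains the
  basis, so its normal is \<open>u\<close> up to sign, and \<open>q\<close> decides the
  sign.\<close>

lemma normal_in_walls:
  assumes u: "unit_outer_normal P F u" and F: "dim F = 3"
  shows "u \<in> W" "F = face {u}"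
proof -
  have uu: "mink u u = 1" and uP: "\<And>x. x \<in> P \<Longrightarrow> mink u x \<le> 0" and FP: "F = P \<inter> hyperplane u"
    using u by (auto simp: unit_outer_normal_def)
  show Fu: "F = face {u}" using P_lobachevsky unfolding FP face_def hyperplane_def by blast
  have "u \<noteq> 0" using uu by (auto simp: mink.zero_left)
  then have "dim {x. mink u x = 0} \<le> dim F" using F by (simp add: dim_mink_orthogonal)
  moreover have "F \<subseteq> {x. mink u x = 0}" by (auto simp: Fu face_def)
  ultimately have "span F = span {x. mink u x = 0}" by (intro dim_eq_span)
  then have spF: "span F = {x. mink u x = 0}"
    using span_eq_iff[THEN iffD2, OF subspace_mink_orthogonal[of u]] by (rule trans)
  obtain B where B: "B \<subseteq> F" "independent B" "F \<subseteq> span B" "card B = dim F"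
    using basis_exists by blast
  have finB: "finite B" "B \<noteq> {}" using B F finiteI_independent by auto
  have spB: "span B = {x. mink u x = 0}"
  proof
    show "span B \<subseteq> {x. mink u x = 0}" using span_mono[OF B(1)] spF by (simp only:)
    show "{x. mink u x = 0} \<subseteq> span B"
      using span_mono[OF B(3)] unfolding span_span spF .
  qed
  define s where "s = (\<Sum>b\<in>B. b)"
  have BP: "b \<in> P" if "b \<in> B" for b using that B Fu by (auto simp: face_def)
  have sc: "s \<in> future_cone" unfolding s_def using finB BP P_future by (intro future_cone_sum) auto
  have es: "mink e s = (\<Sum>b\<in>B. mink e b)" for e by (simp add: s_def mink.sum_right)
  have es0: "mink e s \<le> 0" if "e \<in> W" for e
    unfolding es using BP P_nonpos that by (intro sum_nonpos) auto
  have us: "mink u s = 0" unfolding es using B Fu by (intro sum.neutral) (auto simp: face_def)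
  have "\<exists>e\<in>W. mink e s = 0"
  proof (rule ccontr)
    assume none: "\<not> ?thesis"
    define U where "U = future_cone \<inter> (\<Inter>e'\<in>W. {x. mink e' x < 0})"
    have "open U" unfolding U_def
      using finite_walls
      by (intro open_Int open_future_cone open_INT ballI open_Collect_less mink.continuous_on continuous_intros)
    moreover have "s \<in> U" using sc none es0 by (force simp: U_def)
    ultimately obtain \<epsilon> where \<epsilon>: "\<epsilon> > 0" "s + \<epsilon> *\<^sub>R u \<in> U" by (rule open_perturbation)
    have "mink e' (s + \<epsilon> *\<^sub>R u) \<le> 0" if "e' \<in> W" for e'
      using \<epsilon>(2) that by (auto simp: U_def intro: less_imp_le)
    then obtain r where r: "r > 0" "r *\<^sub>R (s + \<epsilon> *\<^sub>R u) \<in> P"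
      using normalize_in_P[of "s + \<epsilon> *\<^sub>R u"] \<epsilon>(2) unfolding U_def by blast
    have "mink u (r *\<^sub>R (s + \<epsilon> *\<^sub>R u)) = r * \<epsilon>"
      using us uu by (simp add: mink.scaleR_right mink.add_right)
    then show False using uP[OF r(2)] mult_pos_pos[OF r(1) \<epsilon>(1)] by simp
  qed
  then obtain e where e: "e \<in> W" "mink e s = 0" by blast
  have "\<forall>b\<in>B. mink e b = 0"
    using e finB BP P_nonpos unfolding es by (subst (asm) sum_nonpos_eq_0_iff) auto
  then have "span B \<subseteq> {x. mink e x = 0}"
    by (intro span_minimal subspace_mink_orthogonal) auto
  then have orth: "mink e x = 0" if "mink u x = 0" for x using that spB by auto
  have eq: "e = mink e u *\<^sub>R u"
  proof -
    have "mink (e - mink e u *\<^sub>R u) x = 0" for x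
      using orth[of "x - mink u x *\<^sub>R u"] uu by (simp add: mink_expand)
    then show ?thesis using mink_nondegenerate[of "e - mink e u *\<^sub>R u"] by simp
  qed
  then have "mink e e = mink (mink e u *\<^sub>R u) (mink e u *\<^sub>R u)" by simp
  then have "(mink e u)\<^sup>2 = 1" using unit[OF e(1)] uu by (simp add: mink_expand power2_eq_square)
  then have pm: "mink e u = 1 \<or> mink e u = -1" by (simp add: power2_eq_1_iff)
  moreover have "mink e u \<noteq> -1"
  proof
    assume "mink e u = -1"
    then have "mink e q = - mink u q" using eq by (metis mink.minus_left scaleR_minus1_left)
    then show False using q_neg[OF e(1)] uP[OF q_in_P] by simp
  qed
  ultimately have "e = u" using eq by simp
  then show "u \<in> W" using e by simp
qed

text \<open>The order of the normals matters for the use made of it: \<open>u1\<close> and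
  \<open>u2\<close> are the faces through the edge considered, \<open>u3\<close> frames this edge at
  \<open>v\<close>.\<close>

definition corner where
  "corner v u1 u2 u3 \<longleftrightarrow> v \<in> P \<and> active v = {u1, u2, u3} \<and> card (active v) = 3"

lemma cornerD:
  assumes "corner v u1 u2 u3"
  shows "v \<in> P" "active v = {u1, u2, u3}" "card (active v) = 3"
    "u1 \<in> W" "u2 \<in> W" "u3 \<in> W" "mink u1 v = 0" "mink u2 v = 0" "mink u3 v = 0"
    "u1 \<noteq> u2" "u1 \<noteq> u3" "u2 \<noteq> u3"
proof -
  show c: "v \<in> P" "active v = {u1, u2, u3}" "card (active v) = 3" using assms by (auto simp: corner_def)
  show "u1 \<in> W" "u2 \<in> W" "u3 \<in> W" "mink u1 v = 0" "mink u2 v = 0" "mink u3 v = 0"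
    using c(2) unfolding active_def by blast+
  show "u1 \<noteq> u2" "u1 \<noteq> u3" "u2 \<noteq> u3"
    using c(2,3) by (auto simp: card_insert_if split: if_splits)
qed

text \<open>The three active normals are independent in the three-dimensional complement of
  \<open>v\<close>, hence span it. A vector orthogonal to all four is thus a spacelike vector
  orthogonal to itself.\<close>

lemma corner_nondegenerate:
  assumes c: "corner v u1 u2 u3"
    and y: "mink v y = 0" "mink u1 y = 0" "mink u2 y = 0" "mink u3 y = 0"
  shows "y = 0"
proof (rule ccontr)
  assume y0: "y \<noteq> 0"
  note d = cornerD[OF c]
  have "v \<noteq> 0" using mink_self[OF d(1)] by (auto simp: mink.zero_left)
  then have "dim {x. mink v x = 0} = 3" by (simp add: dim_mink_orthogonal)
  moreover have "active v \<subseteq> {x. mink v x = 0}" by (auto simp: active_def mink_commute)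
  ultimately have "{x. mink v x = 0} \<subseteq> span (active v)"
    using card_ge_dim_independent[OF _ independent_active[OF d(1)], of "{x. mink v x = 0}"] d(3) by simp
  moreover have "span (active v) \<subseteq> {x. mink y x = 0}"
    unfolding d(2) using y by (intro span_minimal subspace_mink_orthogonal) (auto simp: mink_commute)
  ultimately have "mink y y = 0" using y(1) by blast
  then show False using mink_positive_on_orthogonal[OF P_future[OF d(1)] y(1) y0] by simp
qed

end

text \<open>For unit vectors, the orthogonal projection to the plane orthogonal to \<open>u1\<close>
  and \<open>u2\<close>, which meets the Lobachevsky space in the line of the edge; the denominator
  is the Gram determinant of \<open>u1\<close> and \<open>u2\<close>. Applied to \<open>u3\<close>
  it gives a normal of the vertex within that line, applied to \<open>q\<close> a multiple of the
  foot of the perpendicular.\<close>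

definition orth_part ::
    "3 pseudo_euclidean \<Rightarrow> 3 pseudo_euclidean \<Rightarrow> 3 pseudo_euclidean \<Rightarrow> 3 pseudo_euclidean" where
  "orth_part u1 u2 x =
     x - ((mink u1 x - mink u1 u2 * mink u2 x) / (1 - (mink u1 u2)\<^sup>2)) *\<^sub>R u1
       - ((mink u2 x - mink u1 u2 * mink u1 x) / (1 - (mink u1 u2)\<^sup>2)) *\<^sub>R u2"

lemma orth_part_orthogonal:
  assumes "mink u1 u1 = 1" "mink u2 u2 = 1" "(mink u1 u2)\<^sup>2 < 1"
  shows "mink u1 (orth_part u1 u2 x) = 0" "mink u2 (orth_part u1 u2 x) = 0"
proof -
  have *: "p - (p - g * r) / (1 - g\<^sup>2) - (r - g * p) / (1 - g\<^sup>2) * g = 0" if "g\<^sup>2 < 1" for p r g :: real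
  proof -
    have "(p - g * r) / (1 - g\<^sup>2) + (r - g * p) / (1 - g\<^sup>2) * g = (p - g * r + (r - g * p) * g) / (1 - g\<^sup>2)"
      by (simp add: add_divide_distrib)
    also have "p - g * r + (r - g * p) * g = p * (1 - g\<^sup>2)"
      by (simp add: algebra_simps power2_eq_square)
    also have "p * (1 - g\<^sup>2) / (1 - g\<^sup>2) = p" using that by simp
    finally show ?thesis by linarith
  qed
  show "mink u1 (orth_part u1 u2 x) = 0"
    using *[OF assms(3)] assms(1) by (simp add: orth_part_def mink_expand)
  have "mink u2 (orth_part u1 u2 x) = mink u2 x
      - (mink u2 x - mink u1 u2 * mink u1 x) / (1 - (mink u1 u2)\<^sup>2)
      - (mink u1 x - mink u1 u2 * mink u2 x) / (1 - (mink u1 u2)\<^sup>2) * mink u1 u2"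
    using assms(2) by (simp add: orth_part_def mink_expand mink_commute[of u2 u1])
  then show "mink u2 (orth_part u1 u2 x) = 0" using *[OF assms(3)] by simp
qed

lemma mink_orth_part:
  assumes "mink u1 y = 0" "mink u2 y = 0"
  shows "mink y (orth_part u1 u2 x) = mink y x" "mink (orth_part u1 u2 x) y = mink x y"
  using assms by (simp_all add: orth_part_def mink_expand mink_commute[of y])

section \<open>Corners, edges and the evaluation of the width\<close>

context acute_polyhedron
begin

text \<open>The vectors in question are orthogonal to the timelike \<open>v\<close> and nonzero by
  independence of the active normals, hence spacelike. For
  \<open>u2 - mink u1 u2 *\<^sub>R u1\<close> this gives the first claim.\<close>

lemma corner_perp:
  assumes c: "corner v u1 u2 u3"
  shows "(mink u1 u2)\<^sup>2 < 1" "mink v (orth_part u1 u2 u3) = 0" "orth_part u1 u2 u3 \<noteq> 0"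
    "mink (orth_part u1 u2 u3) (orth_part u1 u2 u3) > 0"
proof -
  note d = cornerD[OF c]
  have "{u1, u2, u3} = insert u3 {u1, u2}" by blast
  then have ind: "independent (insert u3 {u1, u2})" using independent_active[OF d(1)] d(2) by simp
  then have ind3: "u3 \<notin> span {u1, u2}" using d(11,12) by (simp add: independent_insert)
  have "independent {u2, u1}" by (rule independent_mono[OF ind]) blast
  then have ind2: "u2 \<notin> span {u1}" using d(10) by (simp add: independent_insert)
  define z where "z = u2 - mink u1 u2 *\<^sub>R u1"
  have "z \<noteq> 0" using ind2 by (auto simp: z_def span_singleton)
  moreover have "mink v z = 0" using d by (simp add: z_def mink_expand mink_commute[of v])
  ultimately have "mink z z > 0" using mink_positive_on_orthogonal[OF P_future[OF d(1)]] by blast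
  moreover have "mink z z = 1 - (mink u1 u2)\<^sup>2"
    using unit[OF d(4)] unit[OF d(5)]
    by (simp add: z_def mink_expand mink_commute[of u2 u1] power2_eq_square)
  ultimately show "(mink u1 u2)\<^sup>2 < 1" by simp
  show vo: "mink v (orth_part u1 u2 u3) = 0"
    using d by (simp add: orth_part_def mink_expand mink_commute[of v])
  show "orth_part u1 u2 u3 \<noteq> 0"
  proof
    assume "orth_part u1 u2 u3 = 0"
    then obtain r s where "u3 = r *\<^sub>R u1 + s *\<^sub>R u2" by (auto simp: orth_part_def algebra_simps)
    moreover have "r *\<^sub>R u1 + s *\<^sub>R u2 \<in> span {u1, u2}"
      by (intro span_add span_scale span_base) auto
    ultimately show False using ind3 by simp
  qed
  then show "mink (orth_part u1 u2 u3) (orth_part u1 u2 u3) > 0"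
    using mink_positive_on_orthogonal[OF P_future[OF d(1)] vo] by blast
qed

lemma corner_swap: "corner v u1 u2 u3 \<Longrightarrow> corner v u2 u1 u3" "corner v u1 u2 u3 \<Longrightarrow> corner v u1 u3 u2"
  by (auto simp: corner_def insert_commute)

text \<open>\<open>v\<close> and \<open>f\<close> form an orthogonal basis of the plane orthogonal
  to \<open>u1\<close> and \<open>u2\<close>, with \<open>v\<close> timelike of square -1; this is
  the corresponding expansion.\<close>

lemma corner_plane:
  assumes c: "corner v u1 u2 u3" and x: "mink u1 x = 0" "mink u2 x = 0"
  defines "f \<equiv> orth_part u1 u2 u3"
  shows "x = (- mink v x) *\<^sub>R v + (mink f x / mink f f) *\<^sub>R f"
proof -
  note d = cornerD[OF c]
  note p = corner_perp[OF c, folded f_def]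
  have fo: "mink u1 f = 0" "mink u2 f = 0"
    unfolding f_def using orth_part_orthogonal unit d p(1) by blast+
  define y where "y = x + mink v x *\<^sub>R v - (mink f x / mink f f) *\<^sub>R f"
  have y1: "mink v y = 0" "mink u1 y = 0" "mink u2 y = 0"
    using x p fo mink_self[OF d(1)] d by (simp_all add: y_def mink_expand)
  have "mink f y = 0" using p by (simp add: y_def mink_expand mink_commute[of f v])
  then have "mink u3 y = 0" using mink_orth_part(2)[OF y1(2,3)] by (simp add: f_def)
  then have "y = 0" using corner_nondegenerate[OF c] y1 by blast
  then show ?thesis by (simp add: y_def algebra_simps)
qed

text \<open>An edge with ends \<open>v\<close> and \<open>w\<close> on the faces \<open>u1\<close>
  and \<open>u2\<close>, framed by \<open>u3\<close> at \<open>v\<close> and by \<open>u4\<close> at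
  \<open>w\<close>. The strict inequalities keep each framing face away from the opposite
  end.\<close>

definition edge_config where
  "edge_config v w u1 u2 u3 u4 \<longleftrightarrow> corner v u1 u2 u3 \<and> corner w u1 u2 u4 \<and> mink u4 v < 0 \<and> mink u3 w < 0"

text \<open>The direction \<open>- f\<close> runs along the edge into P: it keeps the products with
  \<open>u1\<close> and \<open>u2\<close> zero and makes that with \<open>u3\<close> negative. The
  exit of this ray is the other end, where the wall reached is the only new one since at most three
  walls are active.\<close>

lemma edge_config_exists:
  assumes c: "corner v u1 u2 u3"
  obtains w u4 where "edge_config v w u1 u2 u3 u4"
proof -
  note d = cornerD[OF c]
  define f where "f = orth_part u1 u2 u3"
  note p = corner_perp[OF c, folded f_def]
  have fo: "mink u1 f = 0" "mink u2 f = 0"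
    unfolding f_def using orth_part_orthogonal unit d p(1) by blast+
  have f3: "mink u3 f = mink f f" using mink_orth_part(2)[OF fo] by (simp add: f_def)
  have "mink e (- f) \<le> 0" if "e \<in> active v" for e
    using that fo f3 p(4) unfolding d(2) by (auto simp: mink.minus_right)
  then obtain s t e where e: "s > 0" "t > 0" "s *\<^sub>R (v + t *\<^sub>R (- f)) \<in> P" "e \<in> W" "mink e v < 0"
    "mink e (v + t *\<^sub>R (- f)) = 0"
    using ray_exit[OF d(1), of "- f"] p by (metis mink.minus_right neg_0_equal_iff_equal neg_equal_0_iff_equal)
  define w where "w = s *\<^sub>R (v + t *\<^sub>R (- f))"
  have w: "w \<in> P" using e by (simp add: w_def)
  have sub: "{u1, u2, e} \<subseteq> active w"
    using e d fo by (auto simp: active_def w_def mink_expand)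
  have ne: "e \<noteq> u1" "e \<noteq> u2" using e d by auto
  then have card: "card {u1, u2, e} = 3" using d(10) by auto
  then have "active w = {u1, u2, e}"
    using card_seteq[OF finite_active sub] card_active_le[OF w] by simp
  moreover have "mink u3 w < 0"
    using e(1,2) p(4) f3 d(9) by (simp add: w_def mink_expand)
  ultimately have "edge_config v w u1 u2 u3 e"
    unfolding edge_config_def using c w card e(5) by (simp add: corner_def[of w])
  then show ?thesis by (rule that)
qed

text \<open>The product with \<open>u3\<close> vanishes at \<open>v\<close> and that with
  \<open>u4\<close> at \<open>w\<close>, so each determines the coefficient of the other end; both
  are nonpositive on P, hence the signs.\<close>

lemma edge_point:
  assumes ec: "edge_config v w u1 u2 u3 u4" and x: "x \<in> face {u1, u2}"
  obtains \<alpha> \<beta> where "\<alpha> \<ge> 0" "\<beta> \<ge> 0" "x = \<alpha> *\<^sub>R v + \<beta> *\<^sub>R w"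
proof -
  have c: "corner v u1 u2 u3" "corner w u1 u2 u4" and neg: "mink u4 v < 0" "mink u3 w < 0"
    using ec by (auto simp: edge_config_def)
  note dv = cornerD[OF c(1)] and dw = cornerD[OF c(2)]
  define f where "f = orth_part u1 u2 u3"
  note p = corner_perp[OF c(1), folded f_def]
  have fo: "mink u1 f = 0" "mink u2 f = 0"
    unfolding f_def using orth_part_orthogonal unit dv p(1) by blast+
  have xP: "x \<in> P" "mink u1 x = 0" "mink u2 x = 0" using x by (auto simp: face_def)
  have f3: "mink f y = mink u3 y" if "mink u1 y = 0" "mink u2 y = 0" for y
    using mink_orth_part(2)[OF that] by (simp add: f_def)
  have wf: "w = (- mink v w) *\<^sub>R v + (mink u3 w / mink f f) *\<^sub>R f"
    using corner_plane[OF c(1), of w] dw f3[of w] by (simp add: f_def)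
  have xf: "x = (- mink v x) *\<^sub>R v + (mink u3 x / mink f f) *\<^sub>R f"
    using corner_plane[OF c(1), of x] xP f3[of x] by (simp add: f_def)
  define \<beta> where "\<beta> = mink u3 x / mink u3 w"
  define \<alpha> where "\<alpha> = - mink v x + \<beta> * mink v w"
  have \<beta>: "\<beta> \<ge> 0" using P_nonpos[OF xP(1) dv(6)] neg by (simp add: \<beta>_def divide_nonpos_neg)
  have "\<alpha> *\<^sub>R v + \<beta> *\<^sub>R w = \<alpha> *\<^sub>R v + \<beta> *\<^sub>R ((- mink v w) *\<^sub>R v + (mink u3 w / mink f f) *\<^sub>R f)"
    using wf by simp
  also have "\<dots> = (\<alpha> - \<beta> * mink v w) *\<^sub>R v + (\<beta> * mink u3 w / mink f f) *\<^sub>R f"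
    by (simp add: algebra_simps)
  also have "\<dots> = x" using xf neg by (simp add: \<alpha>_def \<beta>_def)
  finally have eq: "x = \<alpha> *\<^sub>R v + \<beta> *\<^sub>R w" by simp
  have "mink u4 x = \<alpha> * mink u4 v" using dw by (subst eq) (simp add: mink_expand)
  then have "\<alpha> \<ge> 0" using P_nonpos[OF xP(1) dw(6)] neg by (simp add: mult_le_0_iff)
  then show ?thesis using that \<beta> eq by blast
qed

lemma is_vertex_corner:
  assumes c: "corner v u1 u2 u3"
  shows "is_vertex P v"
proof -
  note d = cornerD[OF c]
  have "face (active v) = {v}"
  proof (intro equalityI subsetI)
    fix x assume x: "x \<in> face (active v)"
    define y where "y = x + mink v x *\<^sub>R v"
    have "y = 0"
      using x d mink_self[OF d(1)] by (intro corner_nondegenerate[OF c]) (auto simp: y_def mink_expand face_def)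
    then have eq: "x = (- mink v x) *\<^sub>R v" by (simp add: y_def eq_neg_iff_add_eq_0)
    then have "- mink v x = 1"
      using lobachevsky_scaleR_eq[OF P_lobachevsky[OF d(1)], of "- mink v x"] x P_lobachevsky by (simp add: face_def)
    then show "x \<in> {v}" using eq by simp
  qed (use d in \<open>auto simp: face_def\<close>)
  moreover have "\<exists>u. unit_outer_normal P (face (active v)) u"
    using d by (intro unit_outer_normal_face[of _ v]) auto
  moreover have "v \<noteq> 0" using mink_self[OF d(1)] by (auto simp: mink.zero_left)
  then have "dim {v} = 1" by (simp add: dim_singleton)
  ultimately show ?thesis unfolding is_vertex_def dim_face_def by simp
qed

lemma edge_config_neq: "edge_config v w u1 u2 u3 u4 \<Longrightarrow> v \<noteq> w"
  unfolding edge_config_def by (metis cornerD(9) less_irrefl)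

lemma edge_config_in_face:
  assumes "edge_config v w u1 u2 u3 u4"
  shows "v \<in> face {u1, u2}" "w \<in> face {u1, u2}"
proof -
  have c: "corner v u1 u2 u3" "corner w u1 u2 u4" using assms by (auto simp: edge_config_def)
  show "v \<in> face {u1, u2}" "w \<in> face {u1, u2}"
    using cornerD(1,7,8)[OF c(1)] cornerD(1,7,8)[OF c(2)] by (simp_all add: face_def)
qed

lemma is_edge_config:
  assumes ec: "edge_config v w u1 u2 u3 u4"
  shows "is_edge P (face {u1, u2})"
proof -
  have c: "corner v u1 u2 u3" "corner w u1 u2 u4" using ec by (auto simp: edge_config_def)
  note dv = cornerD[OF c(1)] and dw = cornerD[OF c(2)]
  have "\<exists>u. unit_outer_normal P (face {u1, u2}) u"
    using dv by (intro unit_outer_normal_face[of _ v]) auto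
  moreover have "dim (face {u1, u2}) = 2"
  proof (rule dim_unique[of "{v, w}"])
    show "{v, w} \<subseteq> face {u1, u2}" using edge_config_in_face[OF ec] by simp
    show "face {u1, u2} \<subseteq> span {v, w}"
    proof
      fix x assume "x \<in> face {u1, u2}"
      then obtain \<alpha> \<beta> where "x = \<alpha> *\<^sub>R v + \<beta> *\<^sub>R w" using edge_point[OF ec] by metis
      then show "x \<in> span {v, w}" by (simp add: span_add span_base span_scale)
    qed
    have "v \<notin> span {w}"
    proof
      assume "v \<in> span {w}"
      then obtain r where "v = r *\<^sub>R w" by (auto simp: span_singleton)
      then have "v = w" using lobachevsky_scaleR_eq[of w r] dv(1) dw(1) P_lobachevsky by auto
      then show False using edge_config_neq[OF ec] by simp
    qed
    moreover have "w \<noteq> 0" using mink_self[OF dw(1)] by (auto simp: mink.zero_left)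
    ultimately show "independent {v, w}" using edge_config_neq[OF ec] by (simp add: independent_insert)
    show "card {v, w} = 2" using edge_config_neq[OF ec] by simp
  qed
  ultimately show ?thesis unfolding is_edge_def dim_face_def by simp
qed

text \<open>The functional supporting P at \<open>x\<close> alone is nonpositive at both ends, so it
  vanishes at any end with a positive coefficient in \<open>x\<close>; that end must be
  \<open>x\<close>.\<close>

lemma vertex_in_edge:
  assumes ec: "edge_config v w u1 u2 u3 u4" and x: "is_vertex P x" "x \<in> face {u1, u2}"
  shows "x = v \<or> x = w"
proof -
  have c: "corner v u1 u2 u3" "corner w u1 u2 u4" using ec by (auto simp: edge_config_def)
  note dv = cornerD[OF c(1)] and dw = cornerD[OF c(2)]
  obtain u where u: "\<And>y. y \<in> P \<Longrightarrow> mink u y \<le> 0" "{x} = P \<inter> hyperplane u"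
    using x(1) by (auto simp: is_vertex_def dim_face_def unit_outer_normal_def)
  obtain \<alpha> \<beta> where ab: "\<alpha> \<ge> 0" "\<beta> \<ge> 0" "x = \<alpha> *\<^sub>R v + \<beta> *\<^sub>R w" using edge_point[OF ec x(2)] .
  have xl: "x \<in> lobachevsky" using x(2) P_lobachevsky by (simp add: face_def)
  show ?thesis
  proof (cases "\<alpha> = 0")
    case True
    then show ?thesis
      using ab lobachevsky_scaleR_eq[of w \<beta>] xl P_lobachevsky[OF dw(1)] by auto
  next
    case False
    have "mink u x = 0" using u(2) by (auto simp: hyperplane_def)
    then have "\<alpha> * mink u v + \<beta> * mink u w = 0" using ab(3) by (simp add: mink_expand)
    moreover have "\<alpha> * mink u v \<le> 0" "\<beta> * mink u w \<le> 0"
      using u(1) dv(1) dw(1) ab by (simp_all add: mult_nonneg_nonpos)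
    ultimately have "\<alpha> * mink u v = 0" by linarith
    then have "v \<in> P \<inter> hyperplane u" using False dv(1) P_lobachevsky by (auto simp: hyperplane_def)
    then have "v \<in> {x}" using u(2) by (simp only:)
    then show ?thesis by simp
  qed
qed

text \<open>Of the three walls active at an end, only one does not contain the edge, so the framing
  normals can only be \<open>u3\<close> and \<open>u4\<close>. Exchanging the two ends does not
  affect the symmetric product, which makes the description definite.\<close>

lemma edge_width_config:
  assumes ec: "edge_config v w u1 u2 u3 u4"
  shows "edge_width P (face {u1, u2}) = \<bar>mink u3 u4\<bar>"
proof -
  have c: "corner v u1 u2 u3" "corner w u1 u2 u4" and neg: "mink u4 v < 0" "mink u3 w < 0"
    using ec by (auto simp: edge_config_def)
  note dv = cornerD[OF c(1)] and dw = cornerD[OF c(2)]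
  note E = edge_config_in_face[OF ec]
  show ?thesis
    unfolding edge_width_def
  proof (rule the_equality)
    have "framing_faces P (face {u1, u2}) (face {u3}) (face {u4})"
      unfolding framing_faces_def
    proof (intro conjI exI)
      show "is_face P (face {u3})" "is_face P (face {u4})" using is_face_wall dv dw by auto
      show "\<not> face {u1, u2} \<subseteq> face {u3}" using E(2) neg by (auto simp: face_def)
      show "\<not> face {u1, u2} \<subseteq> face {u4}" using E(1) neg by (auto simp: face_def)
      show "is_vertex P v" "is_vertex P w" using is_vertex_corner c by auto
    qed (use E edge_config_neq[OF ec] dv dw in \<open>auto simp: face_def\<close>)
    then show "\<exists>F3 F4 n3 n4. framing_faces P (face {u1, u2}) F3 F4 \<and> unit_outer_normal P F3 n3 \<and>
        unit_outer_normal P F4 n4 \<and> \<bar>mink u3 u4\<bar> = \<bar>mink n3 n4\<bar>"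
      using unit_outer_normal_wall dv(6) dw(6) by blast
  next
    fix \<delta>
    assume "\<exists>F3 F4 n3 n4. framing_faces P (face {u1, u2}) F3 F4 \<and> unit_outer_normal P F3 n3 \<and>
        unit_outer_normal P F4 n4 \<and> \<delta> = \<bar>mink n3 n4\<bar>"
    then obtain F3 F4 n3 n4 where F: "framing_faces P (face {u1, u2}) F3 F4"
      and n: "unit_outer_normal P F3 n3" "unit_outer_normal P F4 n4" and \<delta>: "\<delta> = \<bar>mink n3 n4\<bar>" by blast
    obtain x y where xy: "is_vertex P x" "is_vertex P y" "x \<noteq> y" "x \<in> face {u1, u2}" "y \<in> face {u1, u2}"
      "x \<in> F3" "y \<in> F4" using F by (auto simp: framing_faces_def)
    have "dim F3 = 3" "dim F4 = 3" using F by (auto simp: framing_faces_def is_face_def dim_face_def)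
    then have n3: "n3 \<in> W" "F3 = face {n3}" and n4: "n4 \<in> W" "F4 = face {n4}"
      using normal_in_walls n by blast+
    have sub: "face {u1, u2} \<subseteq> face {u1}" "face {u1, u2} \<subseteq> face {u2}" by (auto simp: face_def)
    have "n3 \<noteq> u1" "n3 \<noteq> u2" "n4 \<noteq> u1" "n4 \<noteq> u2"
      using F sub n3 n4 by (auto simp: framing_faces_def)
    moreover have "n3 \<in> active x" "n4 \<in> active y"
      using n3 n4 xy by (auto simp: face_def active_def)
    moreover have "x = v \<and> y = w \<or> x = w \<and> y = v"
      using vertex_in_edge[OF ec] xy by blast
    ultimately have "n3 = u3 \<and> n4 = u4 \<or> n3 = u4 \<and> n4 = u3" using dv(2) dw(2) by auto
    then show "\<delta> = \<bar>mink u3 u4\<bar>" using \<delta> mink_commute by metis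
  qed
qed

end

section \<open>The outermost edge\<close>

text \<open>h1, h2, h3 are sinh of the distances from q to the faces, and the hypothesis compares
  the edges 13 and 12 in face 1. The left side is y (1 - a^2), where y is minus the product of q
  with the projection of the third normal. The last factor is sin sin (1 + cos alpha), with alpha
  the plane angle between the two edges.\<close>

lemma slope_of_outermost:
  fixes a b c h1 h2 h3 :: real
  assumes "0 \<le> a" "0 \<le> b" "0 < h1" "0 < h2" "0 < h3" "a\<^sup>2 < 1" "b\<^sup>2 < 1"
    and le: "(h1\<^sup>2 + 2 * b * h1 * h3 + h3\<^sup>2) / (1 - b\<^sup>2) \<le> (h1\<^sup>2 + 2 * a * h1 * h2 + h2\<^sup>2) / (1 - a\<^sup>2)"
  shows "(h3 + ((b + a * c) * h1 + (c + a * b) * h2) / (1 - a\<^sup>2)) * (1 - a\<^sup>2)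
    \<le> (h2 + a * h1) * (sqrt (1 - a\<^sup>2) * sqrt (1 - b\<^sup>2) + c + a * b)"
proof -
  define s where "s = sqrt (1 - a\<^sup>2)"
  define t where "t = sqrt (1 - b\<^sup>2)"
  have st: "s > 0" "t > 0" "s\<^sup>2 = 1 - a\<^sup>2" "t\<^sup>2 = 1 - b\<^sup>2" using assms by (auto simp: s_def t_def)
  \<comment> \<open>Pythagoras at face 1: h1 is common to both edges, and the second square is the
    product of q with the unit normal of the edge inside the face. Comparing distances to the edges
    thus compares these normal products.\<close>
  have *: "(h1\<^sup>2 + 2 * d * h1 * h + h\<^sup>2) / r\<^sup>2 = h1\<^sup>2 + ((h + d * h1) / r)\<^sup>2"
    if "r\<^sup>2 = 1 - d\<^sup>2" "r > 0" for d r h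
  proof -
    define k where "k = h + d * h1"
    have "h1\<^sup>2 + 2 * d * h1 * h + h\<^sup>2 = h1\<^sup>2 * r\<^sup>2 + k\<^sup>2"
      unfolding that(1) k_def by (simp add: power2_eq_square algebra_simps)
    then show ?thesis unfolding k_def[symmetric] using that(2) by (simp add: add_divide_distrib power_divide)
  qed
  have "((h3 + b * h1) / t)\<^sup>2 \<le> ((h2 + a * h1) / s)\<^sup>2"
    using le *[OF st(4,2), of h3] *[OF st(3,1), of h2] st(3,4) by simp
  then have "(h3 + b * h1) / t \<le> (h2 + a * h1) / s"
    by (rule power2_le_imp_le) (use assms st in auto)
  then have "(h3 + b * h1) * s \<le> (h2 + a * h1) * t" using st by (simp add: field_simps)
  then have "(h3 + b * h1) * s * s \<le> (h2 + a * h1) * t * s" using st by (intro mult_right_mono) auto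
  then have "(h3 + b * h1) * (1 - a\<^sup>2) \<le> (h2 + a * h1) * (s * t)"
    unfolding st(3)[symmetric] by (simp add: power2_eq_square mult_ac)
  moreover have "(h3 + z / (1 - a\<^sup>2)) * (1 - a\<^sup>2) = h3 * (1 - a\<^sup>2) + z" for z
    using assms by (simp add: distrib_right)
  then have "(h3 + ((b + a * c) * h1 + (c + a * b) * h2) / (1 - a\<^sup>2)) * (1 - a\<^sup>2)
      = h3 * (1 - a\<^sup>2) + ((b + a * c) * h1 + (c + a * b) * h2)" .
  moreover have "h3 * (1 - a\<^sup>2) + ((b + a * c) * h1 + (c + a * b) * h2)
      = (h3 + b * h1) * (1 - a\<^sup>2) + (h2 + a * h1) * (c + a * b)"
    by (simp add: power2_eq_square algebra_simps)
  moreover have "(h2 + a * h1) * (s * t + c + a * b) = (h2 + a * h1) * (s * t) + (h2 + a * h1) * (c + a * b)"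
    by (simp only: distrib_left add.assoc)
  ultimately show ?thesis unfolding s_def[symmetric] t_def[symmetric] by linarith
qed

lemma neg_fraction:
  fixes p z d :: real
  shows "p - (- z) / d = p + z / d" "p + (- z) / d = p - z / d" "- (p + (- z) / d) = - p + z / d"
  by simp_all

lemma mink_orth_part_expand:
  "mink y (orth_part u1 u2 x) = mink y x
     - ((mink u1 x - mink u1 u2 * mink u2 x) * mink y u1
        + (mink u2 x - mink u1 u2 * mink u1 x) * mink y u2) / (1 - (mink u1 u2)\<^sup>2)"
  by (simp add: orth_part_def mink_expand add_divide_distrib)

text \<open>The Gram determinant of three vectors of a plane vanishes; multiplied by N, this is the
  claim. Geometrically it is the squared addition formula for cosh, for an edge divided by the foot
  of the perpendicular from q. The hypotheses express the products in the orthogonal basis of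
  \<open>corner_product\<close>, with k the reciprocal of the square of its spacelike
  member.\<close>

lemma plane_gram_identity:
  fixes E k p r y Z N y' E' :: real
  assumes "E * k = 1" "E' = Z\<^sup>2 * k - p\<^sup>2" "N = r\<^sup>2 - y\<^sup>2 * k" "y' = p * r - Z * y * k"
  shows "(Z * N - y * y')\<^sup>2 = (E * N + y\<^sup>2) * (E' * N + y'\<^sup>2)"
proof -
  have "Z * N - y * y' = r * (Z * r - y * p)"
    unfolding assms(3,4) by (simp add: power2_eq_square algebra_simps)
  moreover have "E * N + y\<^sup>2 = E * r\<^sup>2 - y\<^sup>2 * (E * k) + y\<^sup>2"
    unfolding assms(3) by (simp add: algebra_simps)
  then have "E * N + y\<^sup>2 = E * r\<^sup>2" using assms(1) by simp
  moreover have "E' * N + y'\<^sup>2 = k * (Z * r - y * p)\<^sup>2"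
    unfolding assms(2,3,4) by (simp add: power2_eq_square algebra_simps)
  moreover have "(r * (Z * r - y * p))\<^sup>2 = E * k * r\<^sup>2 * (Z * r - y * p)\<^sup>2"
    by (simp add: assms(1) power_mult_distrib)
  ultimately show ?thesis by (simp add: mult_ac)
qed

section \<open>Estimates at the ends of the outermost edge\<close>

context acute_polyhedron
begin

text \<open>The square of the hyperbolic sine of the distance from \<open>q\<close> to the line carrying an edge.\<close>

definition line_distance :: "3 pseudo_euclidean \<Rightarrow> 3 pseudo_euclidean \<Rightarrow> real" where
  "line_distance e e' = ((mink e q)\<^sup>2 - 2 * mink e e' * mink e q * mink e' q + (mink e' q)\<^sup>2) / (1 - (mink e e')\<^sup>2)"

lemma corner_product:
  assumes c: "corner v u1 u2 u3"
    and x: "mink u1 x = 0" "mink u2 x = 0" and y: "mink u1 y = 0" "mink u2 y = 0"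
  defines "f \<equiv> orth_part u1 u2 u3"
  shows "mink x y = mink f x * mink f y / mink f f - mink v x * mink v y"
proof -
  have "mink x y = mink ((- mink v x) *\<^sub>R v + (mink f x / mink f f) *\<^sub>R f) y"
    using corner_plane[OF c x] by (simp add: f_def)
  then show ?thesis by (simp add: mink_expand)
qed

text \<open>Cosines of the dihedral angles are minus the products of the normals. The value of
  \<open>mink f f\<close> is the Gram determinant of \<open>u1\<close>, \<open>u2\<close>,
  \<open>u3\<close> divided by that of \<open>u1\<close>, \<open>u2\<close>.\<close>

lemma corner_coefficients:
  assumes c: "corner v u1 u2 u3"
  defines "a \<equiv> - mink u1 u2" and "b \<equiv> - mink u1 u3" and "c' \<equiv> - mink u2 u3"
    and "f \<equiv> orth_part u1 u2 u3"
  shows "mink f f = 1 - (b\<^sup>2 + c'\<^sup>2 + 2 * a * b * c') / (1 - a\<^sup>2)"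
    and "mink q f = mink u3 q + ((b + a * c') * mink u1 q + (c' + a * b) * mink u2 q) / (1 - a\<^sup>2)"
    and "mink x f = mink x u3 + ((b + a * c') * mink u1 x + (c' + a * b) * mink u2 x) / (1 - a\<^sup>2)"
proof -
  show *: "mink x f = mink x u3 + ((b + a * c') * mink u1 x + (c' + a * b) * mink u2 x) / (1 - a\<^sup>2)" for x
  proof -
    have num: "(mink u1 u3 - mink u1 u2 * mink u2 u3) * mink x u1 + (mink u2 u3 - mink u1 u2 * mink u1 u3) * mink x u2
        = - ((b + a * c') * mink u1 x + (c' + a * b) * mink u2 x)"
      by (simp add: a_def b_def c'_def mink_commute[of x] algebra_simps)
    have den: "1 - (mink u1 u2)\<^sup>2 = 1 - a\<^sup>2" by (simp add: a_def)
    show ?thesis unfolding f_def mink_orth_part_expand num den by (rule neg_fraction)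
  qed
  show "mink q f = mink u3 q + ((b + a * c') * mink u1 q + (c' + a * b) * mink u2 q) / (1 - a\<^sup>2)"
    using *[of q] by (simp add: mink_commute)
  note d = cornerD[OF c]
  have "mink u1 f = 0" "mink u2 f = 0"
    unfolding f_def using orth_part_orthogonal unit d corner_perp(1)[OF c] by blast+
  then have "mink f f = mink u3 f" using mink_orth_part(2) by (simp add: f_def)
  also have "\<dots> = 1 - (b\<^sup>2 + c'\<^sup>2 + 2 * a * b * c') / (1 - a\<^sup>2)"
  proof -
    have num: "(b + a * c') * mink u1 u3 + (c' + a * b) * mink u2 u3 = - (b\<^sup>2 + c'\<^sup>2 + 2 * a * b * c')"
      by (simp add: b_def c'_def power2_eq_square algebra_simps)
    show ?thesis using *[of u3] unfolding num unit[OF d(6)] neg_fraction(2) .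
  qed
  finally show "mink f f = 1 - (b\<^sup>2 + c'\<^sup>2 + 2 * a * b * c') / (1 - a\<^sup>2)" .
qed

lemma corner_nonneg:
  assumes c: "corner v u1 u2 u3"
  shows "0 \<le> - mink u1 u2" "0 \<le> - mink u1 u3" "0 \<le> - mink u2 u3"
  using cornerD[OF c] acute by auto

text \<open>Each of the two other edges at \<open>v\<close> yields one slope bound, so the two faces
  through the edge enter symmetrically. Positivity of \<open>mink f f\<close> is positivity of the
  Gram determinant of the three normals, which together with integrality leaves finitely many vertex
  types.\<close>

lemma corner_estimate:
  assumes c: "corner v u1 u2 u3"
    and int: "\<And>e e'. e \<in> active v \<Longrightarrow> e' \<in> active v \<Longrightarrow> 4 * (mink e e')\<^sup>2 \<in> \<int>"
    and max: "line_distance u1 u3 \<le> line_distance u1 u2" "line_distance u2 u3 \<le> line_distance u1 u2"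
  defines "a \<equiv> - mink u1 u2" and "b \<equiv> - mink u1 u3" and "c' \<equiv> - mink u2 u3"
    and "f \<equiv> orth_part u1 u2 u3"
  shows "\<exists>K. 2 * (- mink q f)\<^sup>2 \<le> (K - mink f f) * line_distance u1 u2 \<and> 2 \<le> K
           \<and> (K \<le> 3.8 \<or> K \<le> 4.2 \<and> a\<^sup>2 = 1/2 \<and> (b = 0 \<and> c' = 1/2 \<or> b = 1/2 \<and> c' = 0))"
proof -
  note d = cornerD[OF c]
  note co = corner_coefficients[OF c, folded a_def b_def c'_def f_def]
  define h1 where "h1 = - mink u1 q"
  define h2 where "h2 = - mink u2 q"
  define h3 where "h3 = - mink u3 q"
  have h: "h1 > 0" "h2 > 0" "h3 > 0" using q_neg d by (auto simp: h1_def h2_def h3_def)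
  have abc: "0 \<le> a" "0 \<le> b" "0 \<le> c'" using corner_nonneg[OF c] by (auto simp: a_def b_def c'_def)
  have sq: "a\<^sup>2 < 1" "b\<^sup>2 < 1" "c'\<^sup>2 < 1"
    using corner_perp(1)[OF c] corner_perp(1)[OF corner_swap(2)[OF c]]
      corner_perp(1)[OF corner_swap(2)[OF corner_swap(1)[OF c]]] by (auto simp: a_def b_def c'_def)
  have dist: "line_distance u1 u2 = (h1\<^sup>2 + 2 * a * h1 * h2 + h2\<^sup>2) / (1 - a\<^sup>2)"
    "line_distance u1 u3 = (h1\<^sup>2 + 2 * b * h1 * h3 + h3\<^sup>2) / (1 - b\<^sup>2)"
    "line_distance u2 u3 = (h2\<^sup>2 + 2 * c' * h2 * h3 + h3\<^sup>2) / (1 - c'\<^sup>2)"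
    by (simp_all add: line_distance_def h1_def h2_def h3_def a_def b_def c'_def)
  define y where "y = h3 + ((b + a * c') * h1 + (c' + a * b) * h2) / (1 - a\<^sup>2)"
  have y: "- mink q f = y"
  proof -
    have num: "(b + a * c') * mink u1 q + (c' + a * b) * mink u2 q = - ((b + a * c') * h1 + (c' + a * b) * h2)"
      by (simp add: h1_def h2_def algebra_simps)
    show ?thesis unfolding co(2) y_def h3_def num by (rule neg_fraction)
  qed
  have "0 \<le> ((b + a * c') * h1 + (c' + a * b) * h2) / (1 - a\<^sup>2)"
    using abc h sq by (intro divide_nonneg_nonneg add_nonneg_nonneg mult_nonneg_nonneg) auto
  then have y0: "0 \<le> y" using h by (simp add: y_def)
  have y1: "y * (1 - a\<^sup>2) \<le> (h2 + a * h1) * (sqrt (1 - a\<^sup>2) * sqrt (1 - b\<^sup>2) + c' + a * b)"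
    unfolding y_def by (rule slope_of_outermost) (use abc h sq max dist in auto)
  have "(h3 + ((c' + a * b) * h2 + (b + a * c') * h1) / (1 - a\<^sup>2)) * (1 - a\<^sup>2)
      \<le> (h1 + a * h2) * (sqrt (1 - a\<^sup>2) * sqrt (1 - c'\<^sup>2) + b + a * c')"
    by (rule slope_of_outermost) (use abc h sq max dist in \<open>auto simp: algebra_simps\<close>)
  then have y2: "y * (1 - a\<^sup>2) \<le> (h1 + a * h2) * (sqrt (1 - a\<^sup>2) * sqrt (1 - c'\<^sup>2) + b + a * c')"
    by (simp add: y_def add.commute)
  have "mink f f > 0" using corner_perp(4)[OF c] by (simp add: f_def)
  then have "(b\<^sup>2 + c'\<^sup>2 + 2 * a * b * c') / (1 - a\<^sup>2) < 1" unfolding co(1) by simp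
  then have less: "a\<^sup>2 + b\<^sup>2 + c'\<^sup>2 + 2 * a * b * c' < 1" using sq(1) by (simp add: divide_less_eq)
  \<comment> \<open>The pair (h1 + a h2, h2 + a h1) is the Gram matrix with entries 1 and a off the
    diagonal applied to (h1, h2); the adjugate matrix, with -a off the diagonal, gives the form in
    the new variables.\<close>
  have D: "line_distance u1 u2 * (1 - a\<^sup>2)\<^sup>2
      = (h2 + a * h1)\<^sup>2 + (h1 + a * h2)\<^sup>2 - 2 * a * (h2 + a * h1) * (h1 + a * h2)"
  proof -
    have "line_distance u1 u2 * (1 - a\<^sup>2) = h1\<^sup>2 + 2 * a * h1 * h2 + h2\<^sup>2" using sq(1) by (simp add: dist)
    then have "line_distance u1 u2 * (1 - a\<^sup>2)\<^sup>2 = (h1\<^sup>2 + 2 * a * h1 * h2 + h2\<^sup>2) * (1 - a\<^sup>2)"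
      by (simp add: power2_eq_square[of "1 - a\<^sup>2"] mult.assoc[symmetric])
    then show ?thesis by (simp add: power2_eq_square algebra_simps)
  qed
  have nat: "\<exists>i::nat. 4 * g\<^sup>2 = real i" if "4 * g\<^sup>2 \<in> \<int>" for g :: real
  proof -
    have "4 * g\<^sup>2 \<in> \<nat>" using that by (simp add: Nats_altdef2)
    then show ?thesis by (auto elim: Nats_cases)
  qed
  have "4 * a\<^sup>2 \<in> \<int>" "4 * b\<^sup>2 \<in> \<int>" "4 * c'\<^sup>2 \<in> \<int>"
    using int d(2) by (auto simp: a_def b_def c'_def)
  then obtain i j k :: nat where "4 * a\<^sup>2 = real i" "4 * b\<^sup>2 = real j" "4 * c'\<^sup>2 = real k"
    using nat by meson
  from crystallographic_vertex_bound[OF abc y0 _ _ this less y1 y2 D]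
  show ?thesis unfolding y co(1) using abc h by (simp add: add_nonneg_nonneg)
qed

text \<open>The projections \<open>f\<close>, \<open>g\<close>, \<open>r\<close> of
  \<open>u3\<close>, \<open>u4\<close>, \<open>q\<close> all lie in the plane of the edge, so their
  Gram matrix is degenerate. Here - mink f g is sqrt(e e') cosh of the length of the edge, and
  \<open>r\<close> points to the foot of the perpendicular from \<open>q\<close>.\<close>

lemma edge_width_less:
  assumes ec: "edge_config v w u1 u2 u3 u4"
    and int: "\<And>v e e'. v \<in> P \<Longrightarrow> e \<in> active v \<Longrightarrow> e' \<in> active v \<Longrightarrow> 4 * (mink e e')\<^sup>2 \<in> \<int>"
    and max: "\<And>e. e \<in> {u3, u4} \<Longrightarrow> line_distance u1 e \<le> line_distance u1 u2 \<and> line_distance u2 e \<le> line_distance u1 u2"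
  shows "edge_width P (face {u1, u2}) < 4.14"
proof -
  have c: "corner v u1 u2 u3" "corner w u1 u2 u4" and neg: "mink u4 v < 0" "mink u3 w < 0"
    using ec by (auto simp: edge_config_def)
  note d3 = cornerD[OF c(1)] and d4 = cornerD[OF c(2)]
  define a where "a = - mink u1 u2"
  define b where "b = - mink u1 u3"
  define c3 where "c3 = - mink u2 u3"
  define b' where "b' = - mink u1 u4"
  define c4 where "c4 = - mink u2 u4"
  define f where "f = orth_part u1 u2 u3"
  define g where "g = orth_part u1 u2 u4"
  define r where "r = orth_part u1 u2 q"
  define D where "D = line_distance u1 u2"
  note cf = corner_coefficients[OF c(1), folded a_def b_def c3_def f_def]
  note cg = corner_coefficients[OF c(2), folded a_def b'_def c4_def g_def]
  have a2: "a\<^sup>2 < 1" using corner_perp(1)[OF c(1)] by (simp add: a_def)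
  have nonneg: "0 \<le> a" "0 \<le> b" "0 \<le> c3" "0 \<le> b'" "0 \<le> c4"
    using corner_nonneg[OF c(1)] corner_nonneg[OF c(2)] by (auto simp: a_def b_def c3_def b'_def c4_def)
  have a1: "a < 1" using a2 nonneg(1) by (simp add: abs_square_less_1)
  have orth: "mink u1 (orth_part u1 u2 x) = 0" "mink u2 (orth_part u1 u2 x) = 0" for x
    using orth_part_orthogonal[OF unit[OF d3(4)] unit[OF d3(5)] corner_perp(1)[OF c(1)]] by blast+
  have prod: "mink x y = mink f x * mink f y / mink f f - mink v x * mink v y"
    if "mink u1 x = 0" "mink u2 x = 0" "mink u1 y = 0" "mink u2 y = 0" for x y
    using corner_product[OF c(1) that] by (simp add: f_def)
  have D0: "0 \<le> D"
  proof -
    have "0 \<le> mink u1 q * mink u2 q"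
      using q_neg[OF d3(4)] q_neg[OF d3(5)] by (intro mult_nonpos_nonpos) auto
    then have "0 \<le> (mink u1 q)\<^sup>2 + 2 * (a * (mink u1 q * mink u2 q)) + (mink u2 q)\<^sup>2"
      using nonneg(1) by simp
    then show ?thesis using a2 by (simp add: D_def line_distance_def a_def mult.assoc)
  qed
  have fpos: "mink f f > 0" and gpos: "mink g g > 0"
    using corner_perp(4)[OF c(1)] corner_perp(4)[OF c(2)] by (auto simp: f_def g_def)
  \<comment> \<open>\<open>q\<close> has square -1 and its component orthogonal to the plane is
    spacelike of square D.\<close>
  have rr: "mink r r = - (1 + D)"
  proof -
    have "mink r r = mink q r" using mink_orth_part(2)[OF orth] by (simp add: r_def)
    also have "\<dots> = - (1 + D)"
    proof -
      have num: "(mink u1 q - mink u1 u2 * mink u2 q) * mink q u1 + (mink u2 q - mink u1 u2 * mink u1 q) * mink q u2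
          = (mink u1 q)\<^sup>2 - 2 * mink u1 u2 * mink u1 q * mink u2 q + (mink u2 q)\<^sup>2"
        by (simp add: mink_commute[of q u1] mink_commute[of q u2] power2_eq_square algebra_simps)
      show ?thesis
        unfolding r_def mink_orth_part_expand num D_def line_distance_def mink_self[OF q_in_P] by simp
    qed
    finally show ?thesis .
  qed
  have fr: "mink f r = mink q f" "mink g r = mink q g"
    unfolding r_def f_def g_def by (rule trans[OF mink_orth_part(1)[OF orth] mink_commute])+
  have gram: "(- mink f g * (1 + D) - (- mink q f) * (- mink q g))\<^sup>2
      = (mink f f * (1 + D) + (- mink q f)\<^sup>2) * (mink g g * (1 + D) + (- mink q g)\<^sup>2)"
  proof (rule plane_gram_identity[where k = "1 / mink f f" and p = "mink v g" and r = "mink v r"])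
    show "mink f f * (1 / mink f f) = 1" using fpos by simp
    show "mink g g = (- mink f g)\<^sup>2 * (1 / mink f f) - (mink v g)\<^sup>2"
      using prod[of g g] orth by (simp add: g_def power2_eq_square)
    show "1 + D = (mink v r)\<^sup>2 - (- mink q f)\<^sup>2 * (1 / mink f f)"
      using prod[of r r] orth rr fr by (simp add: r_def power2_eq_square)
    show "- mink q g = mink v g * mink v r - - mink f g * - mink q f * (1 / mink f f)"
      using prod[of g r] orth fr by (simp add: g_def r_def)
  qed
  \<comment> \<open>Returning from the projections to the normals themselves costs the product of
    the removed components, nonnegative because all the cosines are.\<close>
  have Zeq: "- mink f g = - mink u3 u4 + (b * b' + c3 * c4 + a * (b * c4 + c3 * b')) / (1 - a\<^sup>2)"
  proof -
    have "mink f g = mink u3 g" using mink_orth_part(2)[OF orth] by (simp add: f_def g_def)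
    also have "\<dots> = mink u3 u4 + ((b' + a * c4) * mink u1 u3 + (c4 + a * b') * mink u2 u3) / (1 - a\<^sup>2)"
      by (rule cg(3))
    also have "(b' + a * c4) * mink u1 u3 + (c4 + a * b') * mink u2 u3
        = - (b * b' + c3 * c4 + a * (b * c4 + c3 * b'))"
      by (simp add: b_def c3_def algebra_simps)
    finally have "mink f g = mink u3 u4 + (- (b * b' + c3 * c4 + a * (b * c4 + c3 * b'))) / (1 - a\<^sup>2)" .
    then show ?thesis by (simp only: neg_fraction)
  qed
  have K3: "\<exists>K. 2 * (- mink q f)\<^sup>2 \<le> (K - mink f f) * D \<and> 2 \<le> K
      \<and> (K \<le> 3.8 \<or> K \<le> 4.2 \<and> a\<^sup>2 = 1/2 \<and> (b = 0 \<and> c3 = 1/2 \<or> b = 1/2 \<and> c3 = 0))"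
    unfolding f_def D_def a_def b_def c3_def
    by (rule corner_estimate[OF c(1)]) (use int[OF d3(1)] max in auto)
  have K4: "\<exists>K. 2 * (- mink q g)\<^sup>2 \<le> (K - mink g g) * D \<and> 2 \<le> K
      \<and> (K \<le> 3.8 \<or> K \<le> 4.2 \<and> a\<^sup>2 = 1/2 \<and> (b' = 0 \<and> c4 = 1/2 \<or> b' = 1/2 \<and> c4 = 0))"
    unfolding g_def D_def a_def b'_def c4_def
    by (rule corner_estimate[OF c(2)]) (use int[OF d4(1)] max in auto)
  have "- mink u3 u4 < 4.14"
    using width_less[OF nonneg(1) a1 nonneg(2,3,4,5) D0 cf(1) _ cg(1) _ K3 K4 gram Zeq] fpos gpos by simp
  moreover have "u3 \<noteq> u4" using neg d3 d4 by auto
  then have "mink u3 u4 \<le> 0" using acute d3 d4 by simp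
  ultimately show ?thesis unfolding edge_width_config[OF ec] by simp
qed

theorem outermost_edge:
  assumes int: "\<And>v e e'. v \<in> P \<Longrightarrow> e \<in> active v \<Longrightarrow> e' \<in> active v \<Longrightarrow> 4 * (mink e e')\<^sup>2 \<in> \<int>"
  shows "\<exists>E. is_edge P E \<and> edge_width P E < 4.14"
proof -
  \<comment> \<open>Ordered pairs of distinct walls at a common vertex stand for the edges. They
    form a finite set, so the farthest edge exists without a finiteness argument for edges as
    sets.\<close>
  define S where "S = {p. \<exists>v\<in>P. card (active v) = 3 \<and> fst p \<in> active v \<and> snd p \<in> active v \<and> fst p \<noteq> snd p}"
  define D where "D p = line_distance (fst p) (snd p)" for p
  have "S \<subseteq> W \<times> W" unfolding S_def active_def mem_Times_iff subset_iff by blast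
  then have fin: "finite S" using finite_walls finite_subset by blast
  have S_corner: "(e, e') \<in> S" if "corner v u1 u2 u3" "e \<in> {u1, u2, u3}" "e' \<in> {u1, u2, u3}" "e \<noteq> e'" for v u1 u2 u3 e e'
    unfolding S_def mem_Collect_eq fst_conv snd_conv
    using that(2-4) cornerD(1-3)[OF that(1)] by (intro bexI[of _ v]) simp_all
  obtain v where v: "v \<in> P" "card (active v) = 3" using vertex_exists by blast
  then obtain x y z where "active v = {x, y, z}" "x \<noteq> y" unfolding card_3_iff by blast
  then have "(x, y) \<in> S"
    using v unfolding S_def by (auto intro!: bexI[of _ v] simp del: split_paired_Ex)
  then have "Max (D ` S) \<in> D ` S" using fin by (intro Max_in) auto
  then obtain p where p: "p \<in> S" "D p = Max (D ` S)" by (metis imageE)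
  have pmax: "D p' \<le> D p" if "p' \<in> S" for p' using that fin p by simp
  define u1 where "u1 = fst p"
  define u2 where "u2 = snd p"
  obtain v where v: "v \<in> P" "card (active v) = 3" "u1 \<in> active v" "u2 \<in> active v" "u1 \<noteq> u2"
    using p(1) unfolding S_def u1_def u2_def by blast
  have "card (active v - {u1, u2}) = 1" using v finite_active by (simp add: card_Diff_subset)
  then obtain u3 where "active v - {u1, u2} = {u3}" by (auto simp: card_1_singleton_iff)
  then have "active v = {u1, u2, u3}" using v(3,4) by blast
  then have "corner v u1 u2 u3" using v by (simp add: corner_def)
  then obtain w u4 where ec: "edge_config v w u1 u2 u3 u4" by (rule edge_config_exists)
  then have c: "corner v u1 u2 u3" "corner w u1 u2 u4" by (auto simp: edge_config_def)
  have "line_distance u1 e \<le> line_distance u1 u2 \<and> line_distance u2 e \<le> line_distance u1 u2"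
    if "e \<in> {u3, u4}" for e
  proof -
    have "(u1, u3) \<in> S" "(u2, u3) \<in> S"
      by (rule S_corner[OF c(1)]; use cornerD(11,12)[OF c(1)] in simp)+
    moreover have "(u1, u4) \<in> S" "(u2, u4) \<in> S"
      by (rule S_corner[OF c(2)]; use cornerD(11,12)[OF c(2)] in simp)+
    ultimately have "(u1, e) \<in> S" "(u2, e) \<in> S" using that by blast+
    then show ?thesis using pmax[of "(u1, e)"] pmax[of "(u2, e)"] by (simp add: D_def u1_def u2_def)
  qed
  then have "edge_width P (face {u1, u2}) < 4.14" using int by (rule edge_width_less[OF ec, rotated])
  then show ?thesis using is_edge_config[OF ec] by blast
qed

end

section \<open>Reflections of a hyperbolic lattice\<close>

lemma int_spanI: "(\<Sum>b\<in>B. of_int (c b) *\<^sub>R b) \<in> int_span B"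
  by (auto simp: int_span_def)

lemma int_span_diff: "x \<in> int_span B \<Longrightarrow> y \<in> int_span B \<Longrightarrow> x - y \<in> int_span B"
proof -
  assume "x \<in> int_span B" "y \<in> int_span B"
  then obtain c d where "x = (\<Sum>b\<in>B. of_int (c b) *\<^sub>R b)" "y = (\<Sum>b\<in>B. of_int (d b) *\<^sub>R b)"
    by (auto simp: int_span_def)
  then have "x - y = (\<Sum>b\<in>B. of_int (c b - d b) *\<^sub>R b)"
    by (simp add: sum_subtractf scaleR_diff_left)
  then show ?thesis by (simp only: int_spanI)
qed

lemma int_span_scale: "x \<in> int_span B \<Longrightarrow> of_int k *\<^sub>R x \<in> int_span B"
proof -
  assume "x \<in> int_span B"
  then obtain c where "x = (\<Sum>b\<in>B. of_int (c b) *\<^sub>R b)" by (auto simp: int_span_def)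
  then have "of_int k *\<^sub>R x = (\<Sum>b\<in>B. of_int (k * c b) *\<^sub>R b)"
    by (simp add: scaleR_sum_right)
  then show ?thesis by (simp only: int_spanI)
qed

lemma int_span_base:
  assumes "finite B" "b \<in> B"
  shows "b \<in> int_span B"
proof -
  have "(\<Sum>b'\<in>B. of_int (if b' = b then 1 else 0) *\<^sub>R b') = (\<Sum>b'\<in>B. if b' = b then b' else 0)"
    by (intro sum.cong) auto
  also have "\<dots> = b" using assms by simp
  finally show ?thesis using int_spanI[of "\<lambda>b'. if b' = b then 1 else 0" B] by (simp only:)
qed

text \<open>Coordinates with respect to \<open>B\<close> are bounded linear functionals, so in a
  ball each integer coefficient has finitely many values.\<close>

lemma finite_int_span_bounded:
  fixes B :: "'a::euclidean_space set"
  assumes "independent B"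
  shows "finite (int_span B \<inter> cball 0 r)"
proof -
  have finB: "finite B" using assms by (rule independent_imp_finite)
  have "\<exists>g :: 'a \<Rightarrow> real. linear g \<and> (\<forall>x\<in>B. g x = (if x = b then 1 else 0))" for b
    using linear_independent_extend[OF assms, of "\<lambda>x. if x = b then 1 else 0 :: real"] by blast
  then obtain g :: "'a \<Rightarrow> 'a \<Rightarrow> real"
    where g: "\<And>b. linear (g b)" "\<And>b x. x \<in> B \<Longrightarrow> g b x = (if x = b then 1 else 0)" by metis
  obtain K where K: "\<And>b x. norm (g b x) \<le> norm x * K b"
    using bounded_linear.bounded[OF linear_conv_bounded_linear[THEN iffD1, OF g(1)]] by metis
  define T where "T b = {c::int. \<bar>real_of_int c\<bar> \<le> \<bar>r\<bar> * \<bar>K b\<bar>}" for b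
  have "finite (T b)" for b
  proof (rule finite_subset)
    show "T b \<subseteq> {- \<lceil>\<bar>r\<bar> * \<bar>K b\<bar>\<rceil> .. \<lceil>\<bar>r\<bar> * \<bar>K b\<bar>\<rceil>}"
      unfolding T_def by (auto; linarith)
  qed simp
  then have "finite (PiE B T)" using finB by (intro finite_PiE)
  moreover have "int_span B \<inter> cball 0 r \<subseteq> (\<lambda>c. \<Sum>b\<in>B. of_int (c b) *\<^sub>R b) ` PiE B T"
  proof
    fix x assume x: "x \<in> int_span B \<inter> cball 0 r"
    then obtain c where c: "x = (\<Sum>b\<in>B. of_int (c b) *\<^sub>R b)" by (auto simp: int_span_def)
    have "c b \<in> T b" if b: "b \<in> B" for b
    proof -
      have "g b x = (\<Sum>b'\<in>B. of_int (c b') * g b b')"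
        unfolding c using g(1)[of b] by (simp add: linear_sum linear_scale)
      also have "\<dots> = (\<Sum>b'\<in>B. if b' = b then of_int (c b') else 0)"
        using g(2) by (intro sum.cong) auto
      also have "\<dots> = of_int (c b)" using finB b by simp
      finally have "\<bar>of_int (c b)\<bar> \<le> norm x * K b" using K[of b x] by simp
      also have "\<dots> \<le> norm x * \<bar>K b\<bar>" by (intro mult_left_mono) auto
      also have "\<dots> \<le> \<bar>r\<bar> * \<bar>K b\<bar>" using x by (intro mult_right_mono) auto
      finally show ?thesis by (simp add: T_def)
    qed
    then have "restrict c B \<in> PiE B T" by auto
    moreover have "x = (\<Sum>b\<in>B. of_int (restrict c B b) *\<^sub>R b)" unfolding c by (intro sum.cong) auto
    ultimately show "x \<in> (\<lambda>c. \<Sum>b\<in>B. of_int (c b) *\<^sub>R b) ` PiE B T" by blast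
  qed
  ultimately show ?thesis using finite_surj by blast
qed

lemma reflection_unit: "mink e e = 1 \<Longrightarrow> reflection e x = x - (2 * mink e x) *\<^sub>R e"
  by (simp add: reflection_def)

lemma linear_reflection: "linear (reflection e)"
  by (rule linearI) (simp_all add: reflection_def mink_expand scaleR_add_left add_divide_distrib
      distrib_left scaleR_diff_right)

lemma reflection_scaleR: "c \<noteq> 0 \<Longrightarrow> reflection (c *\<^sub>R e) = reflection e"
  by (rule ext) (simp add: reflection_def mink_expand)

lemma reflection_minus: "reflection (- e) = reflection e"
  using reflection_scaleR[of "-1" e] by simp

lemma reflection_eq_imp:
  assumes "mink e e = 1" "mink e' e' = 1" "reflection e = reflection e'"
  shows "e = e' \<or> e = - e'"
proof -
  have "reflection e e = reflection e' e" using assms(3) by simp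
  then have "e - 2 *\<^sub>R e = e - (2 * mink e' e) *\<^sub>R e'"
    using assms(1,2) by (simp add: reflection_unit)
  then have "2 *\<^sub>R e = (2 * mink e' e) *\<^sub>R e'" by (rule diff_left_imp_eq)
  then have "(1/2) *\<^sub>R (2 *\<^sub>R e) = (1/2) *\<^sub>R ((2 * mink e' e) *\<^sub>R e')" by (simp only:)
  then have e: "e = mink e' e *\<^sub>R e'" by simp
  then have "mink e e = mink (mink e' e *\<^sub>R e') (mink e' e *\<^sub>R e')" by simp
  then have "(mink e' e)\<^sup>2 = 1" using assms(1,2) by (simp add: mink_expand power2_eq_square)
  then have "mink e' e = 1 \<or> mink e' e = -1" by (simp add: power2_eq_1_iff)
  then show ?thesis using e by auto
qed

text \<open>A group of motions permutes the mirrors of its reflections; this is the instance in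
  which the mirror of \<open>e'\<close> is reflected in that of \<open>e\<close>. It is what
  excludes obtuse angles of the chamber.\<close>

lemma reflection_conjugate:
  assumes "mink e e = 1" "mink e' e' = 1"
  defines "u \<equiv> reflection e e'"
  shows "mink u u = 1" "reflection u = reflection e \<circ> reflection e' \<circ> reflection e"
proof -
  have u: "u = e' - (2 * mink e e') *\<^sub>R e" using assms(1) by (simp add: u_def reflection_unit)
  show uu: "mink u u = 1"
    using assms(1,2) by (simp add: u mink_expand mink_commute[of e' e])
  show "reflection u = reflection e \<circ> reflection e' \<circ> reflection e"
  proof
    fix x
    have mu: "mink u x = mink e' x - 2 * mink e e' * mink e x" by (simp add: u mink_expand)
    have "reflection e' (reflection e x) = reflection e x - (2 * mink u x) *\<^sub>R e'"
      using assms(1,2) by (simp add: reflection_unit mink_expand mu mink_commute[of e' e])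
    then have "reflection e (reflection e' (reflection e x))
        = reflection e (reflection e x) - (2 * mink u x) *\<^sub>R reflection e e'"
      using linear_reflection[of e] by (simp add: linear_diff linear_scale)
    also have "reflection e (reflection e x) = x"
      using assms(1) by (simp add: reflection_unit mink_expand algebra_simps)
    finally show "reflection u x = (reflection e \<circ> reflection e' \<circ> reflection e) x"
      using uu by (simp add: reflection_unit u_def)
  qed
qed

text \<open>\<open>x - reflection e x\<close> is the multiple of \<open>e\<close> by
  \<open>2 * mink e x\<close> and lies in \<open>L\<close>. The lattice vectors on the line of
  \<open>e\<close> form a discrete group, nonzero because some basis vector is not orthogonal to
  \<open>e\<close>; \<open>t *\<^sub>R e\<close> is its generator.\<close>

lemma reflection_normal_lattice_multiple:
  fixes L :: "'n::finite pseudo_euclidean set"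
  assumes L: "hyperbolic_lattice L" and e: "mink e e = 1" and r: "reflection e ` L \<subseteq> L"
  obtains t where "t > 0" "t *\<^sub>R e \<in> L" "\<And>x. x \<in> L \<Longrightarrow> \<exists>k::int. 2 * mink e x = of_int k * t"
proof -
  obtain B where B: "independent B" "card B = CARD('n) + 1" "L = int_span B"
    using L by (auto simp: hyperbolic_lattice_def)
  have finB: "finite B" using B(1) by (rule independent_imp_finite)
  have "dim B = DIM('n pseudo_euclidean)" using B by (simp add: dim_eq_card_independent)
  then have spB: "span B = UNIV" by (simp only: dim_eq_full)
  have refl: "(2 * mink e x) *\<^sub>R e \<in> L" if "x \<in> L" for x
  proof -
    have "x - reflection e x \<in> L" using that r B(3) int_span_diff by blast
    then show ?thesis using e by (simp add: reflection_unit)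
  qed
  have "\<exists>b\<in>B. mink e b \<noteq> 0"
  proof (rule ccontr)
    assume "\<not> ?thesis"
    then have "span B \<subseteq> {x. mink e x = 0}" by (intro span_minimal subspace_mink_orthogonal) auto
    then have "e = 0" using spB by (intro mink_nondegenerate) auto
    then show False using e by (simp add: mink.zero_left)
  qed
  then obtain b where b: "b \<in> B" "mink e b \<noteq> 0" by blast
  define T where "T = {t::real. t > 0 \<and> t *\<^sub>R e \<in> L}"
  define t1 where "t1 = \<bar>2 * mink e b\<bar>"
  have bL: "(2 * mink e b) *\<^sub>R e \<in> L" using refl int_span_base[OF finB b(1)] B(3) by simp
  then have "- ((2 * mink e b) *\<^sub>R e) \<in> L" using int_span_scale[of "(2 * mink e b) *\<^sub>R e" B "-1"] B(3) by simp
  then have t1: "t1 \<in> T" using bL b(2) by (auto simp: T_def t1_def abs_if)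
  have e0: "e \<noteq> 0" using e by (auto simp: mink.zero_left)
  have "finite (T \<inter> {..t1})"
  proof (rule finite_imageD)
    show "inj_on (\<lambda>t. t *\<^sub>R e) (T \<inter> {..t1})" using e0 by (auto simp: inj_on_def)
    have "(\<lambda>t. t *\<^sub>R e) ` (T \<inter> {..t1}) \<subseteq> int_span B \<inter> cball 0 (t1 * norm e)"
      using B(3) by (auto simp: T_def intro!: mult_right_mono)
    then show "finite ((\<lambda>t. t *\<^sub>R e) ` (T \<inter> {..t1}))"
      using finite_int_span_bounded[OF B(1)] finite_subset by blast
  qed
  moreover define t where "t = Min (T \<inter> {..t1})"
  ultimately have t: "t \<in> T" "\<And>s. s \<in> T \<Longrightarrow> t \<le> s"
    using t1 Min_in[of "T \<inter> {..t1}"] Min_le[of "T \<inter> {..t1}"]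
    by (auto, metis IntI Min_le atMost_iff linorder_le_cases order_trans Int_iff)
  have "\<exists>k::int. 2 * mink e x = of_int k * t" if "x \<in> L" for x
  proof -
    define s where "s = 2 * mink e x"
    define k where "k = \<lfloor>s / t\<rfloor>"
    have t0: "t > 0" using t(1) by (simp add: T_def)
    have "t *\<^sub>R e \<in> L" using t(1) by (simp add: T_def)
    then have "s *\<^sub>R e - of_int k *\<^sub>R (t *\<^sub>R e) \<in> L"
      using refl[OF that] unfolding B(3) s_def by (intro int_span_diff int_span_scale)
    then have in_L: "(s - of_int k * t) *\<^sub>R e \<in> L" by (simp add: scaleR_diff_left)
    have "of_int k \<le> s / t" "s / t < of_int k + 1" unfolding k_def by linarith+
    then have "of_int k * t \<le> s" "s < (of_int k + 1) * t" using t0 by (simp_all add: field_simps)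
    then have "0 \<le> s - of_int k * t" "s - of_int k * t < t" by (simp_all add: algebra_simps)
    then have "s - of_int k * t = 0" using in_L t(2)[of "s - of_int k * t"] by (force simp: T_def)
    then show ?thesis by (auto simp: s_def)
  qed
  then show ?thesis using that t(1) by (auto simp: T_def)
qed

text \<open>With the primitive lattice vectors along \<open>e\<close> and \<open>e'\<close> as
  roots, \<open>k\<close> and \<open>l\<close> are the two Cartan integers; the lengths cancel in
  their product.\<close>

lemma crystallographic_condition:
  fixes L :: "'n::finite pseudo_euclidean set"
  assumes L: "hyperbolic_lattice L" and e: "mink e e = 1" "reflection e ` L \<subseteq> L"
    and e': "mink e' e' = 1" "reflection e' ` L \<subseteq> L"
  shows "4 * (mink e e')\<^sup>2 \<in> \<int>"
proof -
  obtain t where t: "t > 0" "t *\<^sub>R e \<in> L" "\<And>x. x \<in> L \<Longrightarrow> \<exists>k::int. 2 * mink e x = of_int k * t"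
    using reflection_normal_lattice_multiple[OF L e] by blast
  obtain t' where t': "t' > 0" "t' *\<^sub>R e' \<in> L" "\<And>x. x \<in> L \<Longrightarrow> \<exists>k::int. 2 * mink e' x = of_int k * t'"
    using reflection_normal_lattice_multiple[OF L e'] by blast
  obtain k :: int where k: "2 * (t' * mink e e') = of_int k * t"
    using t(3)[OF t'(2)] by (auto simp: mink_expand)
  obtain l :: int where l: "2 * (t * mink e e') = of_int l * t'"
    using t'(3)[OF t(2)] by (auto simp: mink_expand mink_commute[of e' e])
  have "(2 * (t' * mink e e')) * (2 * (t * mink e e')) = (of_int k * t) * (of_int l * t')"
    unfolding k l ..
  then have "(4 * (mink e e')\<^sup>2) * (t * t') = of_int (k * l) * (t * t')"
    by (simp add: power2_eq_square mult_ac)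
  then have "4 * (mink e e')\<^sup>2 = of_int (k * l)" using t(1) t'(1) by simp
  then show ?thesis by (metis Ints_of_int)
qed

text \<open>The hyperplane meets the ball of radius \<open>\<rho>\<close> in the Klein model, which
  makes the last coordinate of \<open>e\<close> at most \<open>\<rho>\<close> times its spatial
  norm; the normalisation of \<open>e\<close> then bounds the latter.\<close>

lemma normal_bound:
  assumes "mink e e = 1" "mink e x = 0" "snd x > 0" "norm (fst x) \<le> \<rho> * snd x" "0 \<le> \<rho>" "\<rho> < 1"
  shows "norm e \<le> 2 / sqrt (1 - \<rho>\<^sup>2)"
proof -
  have "\<bar>snd e\<bar> * snd x = \<bar>fst e \<bullet> fst x\<bar>" using assms(2,3) by (simp add: mink_def abs_mult)
  also have "\<dots> \<le> norm (fst e) * norm (fst x)" by (rule Cauchy_Schwarz_ineq2)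
  also have "\<dots> \<le> norm (fst e) * (\<rho> * snd x)" using assms by (intro mult_left_mono) auto
  finally have "\<bar>snd e\<bar> \<le> \<rho> * norm (fst e)" using assms(3) by (simp add: mult.commute mult.left_commute)
  then have "\<bar>snd e\<bar>\<^sup>2 \<le> (\<rho> * norm (fst e))\<^sup>2" by (intro power_mono) auto
  then have s: "(snd e)\<^sup>2 \<le> \<rho>\<^sup>2 * (norm (fst e))\<^sup>2" by (simp add: power_mult_distrib)
  have "1 = (norm (fst e))\<^sup>2 - (snd e)\<^sup>2"
    using assms(1) by (simp add: mink_def dot_square_norm flip: power2_eq_square)
  then have f: "(norm (fst e))\<^sup>2 * (1 - \<rho>\<^sup>2) \<le> 1" using s by (simp add: algebra_simps)
  have r1: "1 - \<rho>\<^sup>2 > 0" using assms(5,6) by (simp add: power_less_one_iff abs_square_less_1)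
  have "(norm e)\<^sup>2 = (norm (fst e))\<^sup>2 + (snd e)\<^sup>2" by (simp add: norm_prod_def)
  also have "\<dots> \<le> 2 * (norm (fst e))\<^sup>2"
  proof -
    have "\<rho>\<^sup>2 * (norm (fst e))\<^sup>2 \<le> 1 * (norm (fst e))\<^sup>2" using r1 by (intro mult_right_mono) auto
    then show ?thesis using s by simp
  qed
  also have "\<dots> \<le> 4 * (1 / (1 - \<rho>\<^sup>2))" using f r1 by (simp add: field_simps)
  also have "\<dots> = (2 / sqrt (1 - \<rho>\<^sup>2))\<^sup>2" using r1 by (simp add: power_divide)
  finally show ?thesis by (rule power2_le_imp_le) (use r1 in simp)
qed

text \<open>Such a reflection maps \<open>B\<close> into a bounded, hence finite, part of the
  lattice and is determined by these images; each reflection has only two unit normals.\<close>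

lemma finite_reflection_normals:
  fixes L :: "'n::finite pseudo_euclidean set"
  assumes L: "hyperbolic_lattice L"
  shows "finite {e. mink e e = 1 \<and> reflection e ` L \<subseteq> L \<and> norm e \<le> R}"
proof -
  obtain B where B: "independent B" "card B = CARD('n) + 1" "L = int_span B"
    using L by (auto simp: hyperbolic_lattice_def)
  have finB: "finite B" using B(1) by (rule independent_imp_finite)
  have "dim B = DIM('n pseudo_euclidean)" using B by (simp add: dim_eq_card_independent)
  then have spB: "span B = UNIV" by (simp only: dim_eq_full)
  obtain K where K: "\<And>x y :: 'n pseudo_euclidean. norm (mink x y) \<le> norm x * norm y * K" "0 < K"
    using mink.pos_bounded by blast
  define A where "A = {e. mink e e = 1 \<and> reflection e ` L \<subseteq> L \<and> norm e \<le> R}"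
  define F where "F = PiE B (\<lambda>b. L \<inter> cball 0 (norm b + 2 * (R * norm b * K) * R))"
  have "finite F" unfolding F_def using finB finite_int_span_bounded[OF B(1)] B(3)
    by (intro finite_PiE) auto
  moreover have "A \<subseteq> (\<Union>f\<in>F. {e. mink e e = 1 \<and> restrict (reflection e) B = f})"
  proof
    fix e assume "e \<in> A"
    then have e: "mink e e = 1" "reflection e ` L \<subseteq> L" "norm e \<le> R" by (auto simp: A_def)
    have R0: "0 \<le> R" using e(3) norm_ge_zero order_trans by blast
    have "restrict (reflection e) B \<in> F"
      unfolding F_def
    proof (rule restrict_PiE_iff[THEN iffD2], rule ballI)
      fix b assume b: "b \<in> B"
      have "reflection e b \<in> L" using e(2) int_span_base[OF finB b] B(3) by blast
      moreover have "norm (reflection e b) \<le> norm b + 2 * (R * norm b * K) * R"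
      proof -
        have "\<bar>mink e b\<bar> \<le> norm e * norm b * K" using K(1) by (metis real_norm_def)
        also have "\<dots> \<le> R * norm b * K" using e(3) K(2) by (intro mult_right_mono) auto
        finally have "\<bar>mink e b\<bar> * norm e \<le> R * norm b * K * R"
          using e(3) R0 K(2) by (intro mult_mono) auto
        moreover have "norm (reflection e b) \<le> norm b + norm ((2 * mink e b) *\<^sub>R e)"
          unfolding reflection_unit[OF e(1)] by (rule norm_triangle_ineq4)
        ultimately show ?thesis by (simp add: abs_mult)
      qed
      ultimately show "reflection e b \<in> L \<inter> cball 0 (norm b + 2 * (R * norm b * K) * R)" by simp
    qed
    then show "e \<in> (\<Union>f\<in>F. {e. mink e e = 1 \<and> restrict (reflection e) B = f})" using e(1) by simp
  qed
  moreover have "finite {e. mink e e = 1 \<and> restrict (reflection e) B = f}" for f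
  proof (cases "\<exists>e. mink e e = 1 \<and> restrict (reflection e) B = f")
    case True
    then obtain e0 where e0: "mink e0 e0 = 1" "restrict (reflection e0) B = f" by blast
    have "{e. mink e e = 1 \<and> restrict (reflection e) B = f} \<subseteq> {e0, - e0}"
    proof
      fix e assume "e \<in> {e. mink e e = 1 \<and> restrict (reflection e) B = f}"
      then have e: "mink e e = 1" "restrict (reflection e) B = f" by auto
      have "reflection e b = reflection e0 b" if "b \<in> B" for b
        using e(2) e0(2) that by (metis restrict_apply')
      then have "reflection e x = reflection e0 x" for x
        using linear_eq_on_span[OF linear_reflection linear_reflection] spB by blast
      then show "e \<in> {e0, - e0}" using reflection_eq_imp[OF e(1) e0(1)] by blast
    qed
    then show ?thesis using finite_subset by blast
  next
    case False
    then have "{e. mink e e = 1 \<and> restrict (reflection e) B = f} = {}" by blast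
    then show ?thesis by (simp only: finite.emptyI)
  qed
  ultimately show ?thesis unfolding A_def[symmetric] using finite_UN finite_subset by (metis (no_types, lifting))
qed

section \<open>The fundamental polyhedron\<close>

text \<open>The slice is the continuous central projection of a convex cone.\<close>

lemma connected_lobachevsky_slice:
  fixes M :: "'n::finite pseudo_euclidean set"
  shows "connected {x \<in> lobachevsky. \<forall>e\<in>M. mink e x < 0}"
proof -
  define S where "S = {x \<in> future_cone. \<forall>e\<in>M. mink e x < 0}"
  have "convex S"
  proof (rule convexI)
    fix x y :: "'n pseudo_euclidean" and u v :: real
    assume xy: "x \<in> S" "y \<in> S" and uv: "0 \<le> u" "0 \<le> v" "u + v = 1"
    have u: "u = 1 - v" using uv by simp
    have "u *\<^sub>R x + v *\<^sub>R y \<in> future_cone"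
      unfolding u using xy uv by (intro future_cone_segment) (auto simp: S_def)
    moreover have "mink e (u *\<^sub>R x + v *\<^sub>R y) < 0" if "e \<in> M" for e
    proof (cases "u = 0")
      case True
      then show ?thesis using that xy uv by (simp add: S_def)
    next
      case False
      then have "u * mink e x < 0" using that xy uv by (simp add: S_def mult_pos_neg)
      moreover have "v * mink e y \<le> 0" using that xy uv by (simp add: S_def mult_nonneg_nonpos less_imp_le)
      ultimately show ?thesis by (simp add: mink_expand)
    qed
    ultimately show "u *\<^sub>R x + v *\<^sub>R y \<in> S" by (simp add: S_def)
  qed
  moreover have "continuous_on S normalize_point"
    unfolding normalize_point_def
    by (intro continuous_intros mink.continuous_on) (auto simp: S_def future_cone_iff)
  ultimately have "connected (normalize_point ` S)"
    by (intro connected_continuous_image convex_connected)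
  moreover have "normalize_point ` S = {x \<in> lobachevsky. \<forall>e\<in>M. mink e x < 0}"
  proof
    show "normalize_point ` S \<subseteq> {x \<in> lobachevsky. \<forall>e\<in>M. mink e x < 0}"
    proof (rule image_subsetI)
      fix x assume x: "x \<in> S"
      then have "x \<in> future_cone" by (simp add: S_def)
      then obtain s where "s > 0" "normalize_point x = s *\<^sub>R x" "normalize_point x \<in> lobachevsky"
        by (rule normalize_pointE)
      then show "normalize_point x \<in> {x \<in> lobachevsky. \<forall>e\<in>M. mink e x < 0}"
        using x by (simp add: S_def mink_expand mult_pos_neg)
    qed
    show "{x \<in> lobachevsky. \<forall>e\<in>M. mink e x < 0} \<subseteq> normalize_point ` S"
    proof
      fix x assume x: "x \<in> {x \<in> lobachevsky. \<forall>e\<in>M. mink e x < 0}"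
      then have "x \<in> S" using lobachevsky_subset_future_cone by (auto simp: S_def)
      moreover have "normalize_point x = x"
        using x by (simp add: normalize_point_def lobachevsky_def hyperboloid_def)
      ultimately show "x \<in> normalize_point ` S" by (metis imageI)
    qed
  qed
  ultimately show ?thesis by simp
qed

text \<open>For \<open>q\<close> on no mirror, these are unit normals of all mirrors, signed so that
  \<open>q\<close> is on the negative side; relative to the chamber of \<open>q\<close> they point
  outwards.\<close>

definition inner_normals ::
    "('n::finite pseudo_euclidean \<Rightarrow> 'n pseudo_euclidean) set \<Rightarrow> 'n pseudo_euclidean \<Rightarrow> 'n pseudo_euclidean set" where
  "inner_normals \<Gamma> q = {e. mink e e = 1 \<and> reflection e \<in> \<Gamma> \<and> mink e q < 0}"

lemma mirror_unit_normal:
  assumes "H \<in> mirrors \<Gamma>"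
  obtains e where "mink e e = 1" "reflection e \<in> \<Gamma>" "H = hyperplane e"
proof -
  obtain u where u: "mink u u > 0" "reflection u \<in> \<Gamma>" "H = hyperplane u"
    using assms by (auto simp: mirrors_def)
  define r where "r = 1 / sqrt (mink u u)"
  have r: "r \<noteq> 0" "r * r * mink u u = 1" using u(1) by (auto simp: r_def)
  show ?thesis
  proof (rule that[of "r *\<^sub>R u"])
    show "mink (r *\<^sub>R u) (r *\<^sub>R u) = 1" using r by (simp add: mink_expand)
    show "reflection (r *\<^sub>R u) \<in> \<Gamma>" using u(2) by (simp add: reflection_scaleR[OF r(1)])
    show "H = hyperplane (r *\<^sub>R u)" using u(3) r(1) by (simp add: hyperplane_def mink_expand)
  qed
qed

lemma unit_mirror: "mink e e = 1 \<Longrightarrow> reflection e \<in> \<Gamma> \<Longrightarrow> hyperplane e \<in> mirrors \<Gamma>"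
  unfolding mirrors_def by (intro CollectI exI[of _ e]) simp

text \<open>On the connected chamber no normal product vanishes, so each keeps its sign at
  \<open>q\<close>. Conversely the slice is connected, avoids all mirrors and contains
  \<open>q\<close>.\<close>

lemma chamber_eq:
  assumes C: "C \<in> components (lobachevsky - \<Union>(mirrors \<Gamma>))" and q: "q \<in> C"
  shows "C = {x \<in> lobachevsky. \<forall>e\<in>inner_normals \<Gamma> q. mink e x < 0}"
proof
  have sub: "C \<subseteq> lobachevsky - \<Union>(mirrors \<Gamma>)" using C by (rule in_components_subset)
  have conn: "connected C" using C by (rule in_components_connected)
  show "C \<subseteq> {x \<in> lobachevsky. \<forall>e\<in>inner_normals \<Gamma> q. mink e x < 0}"
  proof (intro subsetI CollectI conjI ballI)
    fix x e assume x: "x \<in> C" and e: "e \<in> inner_normals \<Gamma> q"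
    show "mink e x < 0"
    proof (rule ccontr)
      assume "\<not> ?thesis"
      moreover have "connected (mink e ` C)"
        by (intro connected_continuous_image mink.continuous_on continuous_intros conn)
      moreover have "mink e q \<in> mink e ` C" "mink e x \<in> mink e ` C" using q x by auto
      moreover have "mink e q \<le> 0" using e by (simp add: inner_normals_def)
      ultimately have "0 \<in> mink e ` C" unfolding connected_iff_interval by (meson not_less)
      then obtain y where y: "y \<in> C" "mink e y = 0" by force
      then have "y \<in> hyperplane e" using sub by (auto simp: hyperplane_def)
      moreover have "hyperplane e \<in> mirrors \<Gamma>" using e unit_mirror[of e] by (simp add: inner_normals_def)
      ultimately show False using y(1) sub by blast
    qed
  qed (use sub in blast)
  show "{x \<in> lobachevsky. \<forall>e\<in>inner_normals \<Gamma> q. mink e x < 0} \<subseteq> C" (is "?S \<subseteq> C")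
  proof (rule components_maximal[OF C connected_lobachevsky_slice])
    show "?S \<subseteq> lobachevsky - \<Union>(mirrors \<Gamma>)"
    proof
      fix x assume x: "x \<in> ?S"
      have "x \<notin> H" if H: "H \<in> mirrors \<Gamma>" for H
      proof
        assume xH: "x \<in> H"
        obtain e where e: "mink e e = 1" "reflection e \<in> \<Gamma>" "H = hyperplane e"
          using mirror_unit_normal[OF H] .
        have "mink e q \<noteq> 0" using q sub H e(3) by (auto simp: hyperplane_def)
        then have "e \<in> inner_normals \<Gamma> q \<or> - e \<in> inner_normals \<Gamma> q"
          using e by (auto simp: inner_normals_def mink.minus_left mink.minus_right reflection_minus)
        then have "mink e x \<noteq> 0" using x by (force simp: mink.minus_left)
        then show False using xH e(3) by (simp add: hyperplane_def)
      qed
      then show "x \<in> lobachevsky - \<Union>(mirrors \<Gamma>)" using x by blast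
    qed
    have "q \<in> ?S" using q sub by (auto simp: inner_normals_def)
    then show "C \<inter> ?S \<noteq> {}" using q by blast
  qed
qed

text \<open>Moving a boundary point slightly towards \<open>q\<close> makes all inequalities strict,
  even for infinitely many mirrors.\<close>

lemma closure_slice:
  fixes M :: "'n::finite pseudo_euclidean set"
  assumes q: "q \<in> lobachevsky" "\<And>e. e \<in> M \<Longrightarrow> mink e q < 0"
  shows "closure {x \<in> lobachevsky. \<forall>e\<in>M. mink e x < 0} = {x \<in> lobachevsky. \<forall>e\<in>M. mink e x \<le> 0}"
    (is "closure ?C = ?P")
proof
  have "?P = lobachevsky \<inter> (\<Inter>e\<in>M. {x. mink e x \<le> 0})" by auto
  moreover have "closed (lobachevsky \<inter> (\<Inter>e\<in>M. {x. mink e x \<le> 0}))"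
    by (intro closed_Int closed_lobachevsky closed_INT ballI closed_Collect_le mink.continuous_on
        continuous_intros)
  ultimately have "closed ?P" by simp
  then show "closure ?C \<subseteq> ?P" by (intro closure_minimal) (auto intro: less_imp_le)
  show "?P \<subseteq> closure ?C"
  proof
    fix x assume x: "x \<in> ?P"
    define z where "z t = (1 - t) *\<^sub>R x + t *\<^sub>R q" for t
    have xq: "x \<in> future_cone" "q \<in> future_cone" using x q lobachevsky_subset_future_cone by auto
    have inC: "normalize_point (z t) \<in> ?C" if t: "0 < t" "t \<le> 1" for t
    proof -
      have "z t \<in> future_cone" unfolding z_def using xq t by (intro future_cone_segment) auto
      then obtain s where s: "s > 0" "normalize_point (z t) = s *\<^sub>R z t" "normalize_point (z t) \<in> lobachevsky"
        by (rule normalize_pointE)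
      have "mink e (z t) < 0" if "e \<in> M" for e
      proof -
        have "(1 - t) * mink e x \<le> 0" using x that t by (simp add: mult_nonneg_nonpos)
        moreover have "t * mink e q < 0" using q(2)[OF that] t by (simp add: mult_pos_neg)
        ultimately show ?thesis by (simp add: z_def mink_expand)
      qed
      then show ?thesis using s by (simp add: mink.scaleR_right mult_pos_neg)
    qed
    have "eventually (\<lambda>t. 0 < t \<and> t \<le> (1::real)) (at_right 0)"
      using eventually_at_right_real[OF zero_less_one] by (rule eventually_mono) auto
    then have "eventually (\<lambda>t. normalize_point (z t) \<in> closure ?C) (at_right 0)"
      by (rule eventually_mono) (use inC closure_subset in blast)
    moreover have "((\<lambda>t. normalize_point (z t)) \<longlongrightarrow> normalize_point (z 0)) (at_right 0)"
    proof -
      have "mink x x = -1" using x by (simp add: lobachevsky_def hyperboloid_def)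
      then show ?thesis
        unfolding normalize_point_def z_def by (intro tendsto_intros mink.tendsto) auto
    qed
    ultimately have "normalize_point (z 0) \<in> closure ?C"
      by (intro Lim_in_closed_set[OF closed_closure _ trivial_limit_at_right_real])
    moreover have "normalize_point (z 0) = x"
      using x by (simp add: z_def normalize_point_def lobachevsky_def hyperboloid_def)
    ultimately show "x \<in> closure ?C" by simp
  qed
qed

text \<open>In the Klein model \<open>x \<mapsto> fst x / snd x\<close> a compact polyhedron lies in a ball of radius
  \<open>\<rho> < 1\<close>; the mirrors missing this ball do not contribute to the boundary.\<close>

lemma finitely_many_walls:
  fixes M :: "'n::finite pseudo_euclidean set"
  assumes P: "P = {x \<in> lobachevsky. \<forall>e\<in>M. mink e x \<le> 0}" and cP: "compact P"
    and q: "q \<in> lobachevsky" "\<And>e. e \<in> M \<Longrightarrow> mink e q < 0"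
    and M: "\<And>e. e \<in> M \<Longrightarrow> mink e e = 1" and fin: "\<And>R. finite {e \<in> M. norm e \<le> R}"
  obtains N where "finite N" "N \<subseteq> M" "P = {x \<in> lobachevsky. \<forall>e\<in>N. mink e x \<le> 0}"
proof -
  have qP: "q \<in> P" using q by (auto simp: P intro: less_imp_le)
  have snd0: "snd x > 0" if "x \<in> future_cone" for x :: "'n pseudo_euclidean"
    using that by (simp add: future_cone_iff)
  have PF: "x \<in> future_cone" if "x \<in> P" for x using that lobachevsky_subset_future_cone by (auto simp: P)
  have "continuous_on P (\<lambda>x. norm (fst x) / snd x)"
    using snd0 PF by (intro continuous_intros) fastforce
  then obtain m where m: "m \<in> P" "\<And>x. x \<in> P \<Longrightarrow> norm (fst x) / snd x \<le> norm (fst m) / snd m"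
    using continuous_attains_sup[OF cP] qP by blast
  define \<mu> where "\<mu> = norm (fst m) / snd m"
  \<comment> \<open>Strictly between the Klein radius of P and 1: the sphere of radius
    \<open>\<rho>\<close> is disjoint from P, and normals of mirrors meeting its ball are
    bounded.\<close>
  define \<rho> where "\<rho> = (\<mu> + 1) / 2"
  have "0 \<le> \<mu>" "\<mu> < 1" using PF[OF m(1)] snd0[OF PF[OF m(1)]] by (auto simp: \<mu>_def future_cone_def)
  then have \<rho>: "0 \<le> \<rho>" "\<rho> < 1" "\<mu> < \<rho>" by (auto simp: \<rho>_def)
  have inside: "norm (fst x) < \<rho> * snd x" if "x \<in> P" for x
  proof -
    have "norm (fst x) / snd x < \<rho>" using m(2)[OF that] \<rho> by (simp add: \<mu>_def)
    then show ?thesis using snd0[OF PF[OF that]] by (simp add: divide_less_eq)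
  qed
  define N where "N = {e \<in> M. \<exists>x. snd x > 0 \<and> norm (fst x) \<le> \<rho> * snd x \<and> mink e x = 0}"
  have "N \<subseteq> {e \<in> M. norm e \<le> 2 / sqrt (1 - \<rho>\<^sup>2)}"
    using normal_bound M \<rho> unfolding N_def by blast
  then have finN: "finite N" using fin finite_subset by blast
  have near: "x \<in> P" if x: "x \<in> lobachevsky" "\<And>e. e \<in> N \<Longrightarrow> mink e x \<le> 0" "norm (fst x) \<le> \<rho> * snd x" for x
  proof -
    have "mink e x \<le> 0" if e: "e \<in> M" for e
    proof (rule ccontr)
      assume pos: "\<not> ?thesis"
      have neg: "mink e q < 0" using q(2)[OF e] .
      define t where "t = - mink e q / (mink e x - mink e q)"
      have t: "0 < t" "t < 1" using pos neg by (auto simp: t_def field_simps)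
      define z where "z = (1 - t) *\<^sub>R q + t *\<^sub>R x"
      have "mink e z = mink e q + t * (mink e x - mink e q)" by (simp add: z_def mink_expand algebra_simps)
      also have "\<dots> = 0" using pos neg by (simp add: t_def)
      finally have z0: "mink e z = 0" .
      have sx: "snd x > 0" "snd q > 0" using x(1) q(1) by (auto simp: lobachevsky_def)
      have "snd z = (1 - t) * snd q + t * snd x" by (simp add: z_def)
      moreover have "0 < (1 - t) * snd q" "0 < t * snd x" using t sx by auto
      ultimately have "snd z > 0" by linarith
      moreover have "norm (fst z) \<le> \<rho> * snd z"
      proof -
        have "norm (fst z) \<le> norm ((1 - t) *\<^sub>R fst q) + norm (t *\<^sub>R fst x)"
          unfolding z_def by (simp add: norm_triangle_ineq flip: norm_scaleR)
        also have "\<dots> = (1 - t) * norm (fst q) + t * norm (fst x)" using t by simp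
        also have "\<dots> \<le> (1 - t) * (\<rho> * snd q) + t * (\<rho> * snd x)"
          using inside[OF qP] x(3) t by (intro add_mono mult_left_mono) auto
        also have "\<dots> = \<rho> * snd z" by (simp add: z_def algebra_simps)
        finally show ?thesis .
      qed
      ultimately have "e \<in> N" using e z0 unfolding N_def by blast
      then show False using x(2) pos by blast
    qed
    then show ?thesis using x(1) by (simp add: P)
  qed
  have "x \<in> P" if x: "x \<in> lobachevsky" "\<And>e. e \<in> N \<Longrightarrow> mink e x \<le> 0" for x
  proof (cases "norm (fst x) \<le> \<rho> * snd x")
    case True
    then show ?thesis using near x by blast
  next
    case False
    \<comment> \<open>On the segment from \<open>q\<close> to an outside point some point lies on
      the sphere of radius \<open>\<rho>\<close>. It satisfies the inequalities of \<open>N\<close>,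
      hence is in P, which does not reach this sphere.\<close>
    define z where "z t = (1 - t) *\<^sub>R q + t *\<^sub>R x" for t
    define \<phi> where "\<phi> t = norm (fst (z t)) - \<rho> * snd (z t)" for t
    have "\<phi> 0 \<le> 0" "0 \<le> \<phi> 1" using inside[OF qP] False by (auto simp: \<phi>_def z_def)
    moreover have "continuous_on {0..1} \<phi>"
      unfolding \<phi>_def z_def by (intro continuous_intros)
    ultimately obtain t where t: "0 \<le> t" "t \<le> 1" "\<phi> t = 0"
      using IVT'[of \<phi> 0 0 1] by auto
    have "z t \<in> future_cone" unfolding z_def
      using x(1) q(1) lobachevsky_subset_future_cone t by (intro future_cone_segment) auto
    then obtain s where s: "s > 0" "normalize_point (z t) = s *\<^sub>R z t" "normalize_point (z t) \<in> lobachevsky"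
      by (rule normalize_pointE)
    define y where "y = s *\<^sub>R z t"
    have y\<rho>: "norm (fst y) = \<rho> * snd y" using t(3) s(1) by (simp add: y_def \<phi>_def)
    have "mink e y \<le> 0" if e: "e \<in> N" for e
    proof -
      have "(1 - t) * mink e q \<le> 0" using q(2)[of e] e t by (intro mult_nonneg_nonpos) (simp_all add: N_def)
      moreover have "t * mink e x \<le> 0" using x(2)[OF e] t by (intro mult_nonneg_nonpos)
      ultimately have "mink e (z t) \<le> 0" by (simp add: z_def mink_expand)
      then show ?thesis using s(1) by (simp add: y_def mink.scaleR_right mult_nonneg_nonpos)
    qed
    then have "y \<in> P" using near s(2,3) y\<rho> by (simp add: y_def)
    then show ?thesis using inside y\<rho> by fastforce
  qed
  then have "P = {x \<in> lobachevsky. \<forall>e\<in>N. mink e x \<le> 0}" by (auto simp: P N_def)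
  then show ?thesis using that finN by (simp add: N_def)
qed

text \<open>In a set of least cardinality, dropping \<open>e\<close> admits a point beyond the
  hyperplane of \<open>e\<close>. The segment to it from \<open>q\<close> crosses this hyperplane
  where all other inequalities are strict.\<close>

lemma minimal_walls:
  fixes N :: "'n::finite pseudo_euclidean set"
  assumes "finite N" "P = {x \<in> lobachevsky. \<forall>e\<in>N. mink e x \<le> 0}"
    and q: "q \<in> lobachevsky" "\<And>e. e \<in> N \<Longrightarrow> mink e q < 0"
  obtains W where "W \<subseteq> N" "P = {x \<in> lobachevsky. \<forall>e\<in>W. mink e x \<le> 0}"
    "\<And>e. e \<in> W \<Longrightarrow> \<exists>x\<in>P. mink e x = 0 \<and> (\<forall>e'\<in>W - {e}. mink e' x < 0)"
proof -
  define Q where "Q W \<longleftrightarrow> W \<subseteq> N \<and> P = {x \<in> lobachevsky. \<forall>e\<in>W. mink e x \<le> 0}" for W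
  have "Q N" using assms(2) by (simp add: Q_def)
  then obtain W where W: "Q W" "\<And>W'. Q W' \<Longrightarrow> card W \<le> card W'"
    using ex_has_least_nat[of Q N card] by blast
  have finW: "finite W" using W(1) assms(1) finite_subset by (auto simp: Q_def)
  have WN: "W \<subseteq> N" and PW: "P = {x \<in> lobachevsky. \<forall>e\<in>W. mink e x \<le> 0}" using W(1) by (auto simp: Q_def)
  have "\<exists>x\<in>P. mink e x = 0 \<and> (\<forall>e'\<in>W - {e}. mink e' x < 0)" if e: "e \<in> W" for e
  proof -
    have "card (W - {e}) < card W" using e finW by (meson card_Diff1_less)
    then have "\<not> Q (W - {e})" using W(2) by fastforce
    then have "P \<noteq> {x \<in> lobachevsky. \<forall>e'\<in>W - {e}. mink e' x \<le> 0}" using WN by (auto simp: Q_def)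
    moreover have "P \<subseteq> {x \<in> lobachevsky. \<forall>e'\<in>W - {e}. mink e' x \<le> 0}" unfolding PW by blast
    ultimately obtain z where z: "z \<in> lobachevsky" "\<And>e'. e' \<in> W - {e} \<Longrightarrow> mink e' z \<le> 0" "z \<notin> P" by blast
    have pos: "mink e z > 0" using z PW by (force simp: not_le)
    have neg: "mink e q < 0" using q(2) e WN by blast
    define t where "t = - mink e q / (mink e z - mink e q)"
    have t: "0 < t" "t < 1" using pos neg by (auto simp: t_def field_simps)
    define x where "x = (1 - t) *\<^sub>R q + t *\<^sub>R z"
    have "mink e x = mink e q + t * (mink e z - mink e q)" by (simp add: x_def mink_expand algebra_simps)
    also have "\<dots> = 0" using pos neg by (simp add: t_def)
    finally have x0: "mink e x = 0" .
    have xn: "mink e' x < 0" if e': "e' \<in> W - {e}" for e'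
    proof -
      have "mink e' q < 0" using q(2) e' WN by blast
      then have "(1 - t) * mink e' q < 0" using t by (intro mult_pos_neg) auto
      moreover have "t * mink e' z \<le> 0" using z(2)[OF e'] t by (intro mult_nonneg_nonpos) auto
      ultimately show ?thesis by (simp add: x_def mink_expand)
    qed
    have "x \<in> future_cone" unfolding x_def
      using z(1) q(1) lobachevsky_subset_future_cone t by (intro future_cone_segment) auto
    then obtain s where s: "s > 0" "normalize_point x = s *\<^sub>R x" "normalize_point x \<in> lobachevsky"
      by (rule normalize_pointE)
    have y0: "mink e (s *\<^sub>R x) = 0" using x0 by (simp add: mink.scaleR_right)
    have yn: "mink e' (s *\<^sub>R x) < 0" if e': "e' \<in> W - {e}" for e'
      using xn[OF e'] s(1) by (simp add: mink.scaleR_right mult_pos_neg)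
    have "mink e' (s *\<^sub>R x) \<le> 0" if "e' \<in> W" for e'
      using y0 yn[of e'] that by (cases "e' = e") (auto intro: less_imp_le)
    then have "s *\<^sub>R x \<in> P" using s by (simp add: PW)
    then show ?thesis using y0 yn by blast
  qed
  then show ?thesis using that WN PW by blast
qed

theorem theorem1:
  fixes \<Gamma> :: "(3 pseudo_euclidean \<Rightarrow> 3 pseudo_euclidean) set"
    and P :: "3 pseudo_euclidean set"
  assumes "arithmetic_reflection_group \<Gamma>"
    and "cocompact \<Gamma>"
    and "fundamental_polyhedron \<Gamma> P"
  shows "\<exists>E. is_edge P E \<and> edge_width P E < 4.14"
proof -
  obtain L where L: "hyperbolic_lattice L" "subgroup \<Gamma> (motions\<lparr>carrier := lattice_group L\<rparr>)"
    using assms(1) by (auto simp: arithmetic_reflection_group_def)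
  have "\<Gamma> \<subseteq> lattice_group L" using subgroup.subset[OF L(2)] by simp
  then have \<Gamma>L: "g ` L \<subseteq> L" if "g \<in> \<Gamma>" for g using that by (auto simp: lattice_group_def)
  have comp: "g \<circ> h \<in> \<Gamma>" if "g \<in> \<Gamma>" "h \<in> \<Gamma>" for g h
    using subgroup.m_closed[OF L(2) that] by (simp add: motions_def)
  have cP: "compact P" using assms(2,3) by (auto simp: cocompact_def)
  obtain C where C: "C \<in> components (lobachevsky - \<Union>(mirrors \<Gamma>))" "P = closure C"
    using assms(3) by (auto simp: fundamental_polyhedron_def)
  obtain q where q: "q \<in> C" using in_components_nonempty[OF C(1)] by blast
  have ql: "q \<in> lobachevsky" "q \<notin> \<Union>(mirrors \<Gamma>)" using q in_components_subset[OF C(1)] by auto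
  define M where "M = inner_normals \<Gamma> q"
  have M: "mink e e = 1" "reflection e \<in> \<Gamma>" "mink e q < 0" if "e \<in> M" for e
    using that by (auto simp: M_def inner_normals_def)
  have PM: "P = {x \<in> lobachevsky. \<forall>e\<in>M. mink e x \<le> 0}"
    unfolding C(2) chamber_eq[OF C(1) q] M_def[symmetric] using ql(1) M(3) by (rule closure_slice)
  have "finite {e \<in> M. norm e \<le> R}" for R
    by (rule finite_subset[OF _ finite_reflection_normals[OF L(1), of R]]) (use M \<Gamma>L in blast)
  then obtain N where N: "finite N" "N \<subseteq> M" "P = {x \<in> lobachevsky. \<forall>e\<in>N. mink e x \<le> 0}"
    using finitely_many_walls[OF PM cP ql(1) M(3) M(1)] by blast
  have Nq: "mink e q < 0" if "e \<in> N" for e using that N(2) M(3) by blast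
  obtain W where W: "W \<subseteq> N" "P = {x \<in> lobachevsky. \<forall>e\<in>W. mink e x \<le> 0}"
    "\<And>e. e \<in> W \<Longrightarrow> \<exists>x\<in>P. mink e x = 0 \<and> (\<forall>e'\<in>W - {e}. mink e' x < 0)"
    using minimal_walls[OF N(1,3) ql(1) Nq] by blast
  have WM: "e \<in> M" if "e \<in> W" for e using that W(1) N(2) by blast
  interpret acute_polyhedron W P q
  proof
    show "finite W" using W(1) N(1) finite_subset by blast
    show "bounded P" using cP by (rule compact_imp_bounded)
    show "mink e e' \<le> 0" if e: "e \<in> W" "e' \<in> W" "e \<noteq> e'" for e e'
    proof (rule ccontr)
      assume pos: "\<not> ?thesis"
      \<comment> \<open>If the product of \<open>e\<close> and \<open>e'\<close> were positive, the
        mirror of \<open>e'\<close> reflected in that of \<open>e\<close> would separate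
        \<open>x\<close> on wall \<open>e\<close> from \<open>y\<close> on wall \<open>e'\<close>;
        but no mirror separates points of the closed chamber.\<close>
      define u where "u = reflection e e'"
      have u: "mink u u = 1" "reflection u \<in> \<Gamma>"
        using reflection_conjugate[of e e'] M WM e comp by (auto simp: u_def)
      have ux: "mink u x = mink e' x - 2 * mink e e' * mink e x" for x
        using M(1)[OF WM[OF e(1)]] by (simp add: u_def reflection_unit mink_expand)
      obtain x where x: "x \<in> P" "mink e x = 0" "mink e' x < 0" using W(3)[OF e(1)] e by blast
      obtain y where y: "y \<in> P" "mink e' y = 0" "mink e y < 0" using W(3)[OF e(2)] e by blast
      have x': "mink u x < 0" using x by (simp add: ux)
      have y': "mink u y > 0" using y pos by (simp add: ux mult_pos_neg)
      have "mink u q \<noteq> 0" using unit_mirror[OF u] ql by (auto simp: hyperplane_def)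
      then have "u \<in> M \<or> - u \<in> M"
        using u by (auto simp: M_def inner_normals_def mink.minus_left mink.minus_right reflection_minus)
      then show False
      proof
        assume "u \<in> M"
        then show False using y(1) y' by (auto simp: PM)
      next
        assume "- u \<in> M"
        then have "mink (- u) x \<le> 0" using x(1) by (simp add: PM)
        then show False using x' by (simp add: mink.minus_left)
      qed
    qed
  qed (use W(2,3) ql M WM in blast)+
  show ?thesis
  proof (rule outermost_edge)
    fix v e e' assume "e \<in> active v" "e' \<in> active v"
    then have "e \<in> M" "e' \<in> M" using WM by (auto simp: active_def)
    then show "4 * (mink e e')\<^sup>2 \<in> \<int>"
      using M \<Gamma>L by (intro crystallographic_condition[OF L(1)]) auto
  qed
qed

end
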